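(* For each prime $p$ with $5\le p\le 19$ let $\mathcal E_p(\tau)=\frac{2}{p-1}\sum_{\chi}E_{1,\chi}(\tau)$, the sum over the odd primitive Dirichlet characters $\chi$ modulo $p$. Then $$\mathcal E_5=\frac{(q;q)_\infty^2}{(q,q^4;q^5)_\infty^5},\quad \mathcal E_7=\frac{(q^3,q^4,q^7,q^7;q^7)_\infty}{(q,q^6;q^7)_\infty^2},\quad \mathcal E_{11}=\frac{(q^4,q^7,q^{11},q^{11};q^{11})_\infty}{(q,q^{10},q^2,q^9;q^{11})_\infty},$$ $$\mathcal E_{13}=\frac{(q^6,q^7,q^{13},q^{13};q^{13})_\infty}{(q,q^{12},q^3,q^{10};q^{13})_\infty},\quad \mathcal E_{17}=\frac{(q^8,q^9,q^{17},q^{17};q^{17})_\infty}{(q^2,q^{15},q^3,q^{14};q^{17})_\infty},$$ $$\mathcal E_{19}=\frac{(q^8,q^{11},q^9,q^{10},q^{19},q^{19};q^{19})_\infty}{(q^3,q^{16},q^4,q^{15},q^5,q^{14};q^{19})_\infty}.$$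
   Context: $q=e^{2\pi i\tau}$ with $\tau$ in the upper half plane; $(a;q)_\infty=\prod_{j\ge0}(1-aq^j)$, $(a_1,\dots,a_r;q)_\infty=\prod_i(a_i;q)_\infty$. For an odd Dirichlet character $\chi$ modulo $p$ ($\chi(-1)=-1$), $E_{1,\chi}(\tau)=1+\frac{2}{L(0,\chi)}\sum_{n\ge1}\chi(n)\frac{q^n}{1-q^n}$, where $L(0,\chi)$ is the value at $s=0$ of the analytic continuation of the Dirichlet $L$-series $L(s,\chi)$. *)

theory Defs
  imports "HOL-Complex_Analysis.Complex_Analysis" "HOL-Computational_Algebra.Primes"
begin

definition qpoch :: "complex \<Rightarrow> complex \<Rightarrow> complex" where
  "qpoch a q = (\<Prod>j. 1 - a * q ^ j)"

text \<open>\<^term>\<open>qpochs [a1, a2] q\<close> is $(a_1, a_2; q)_\infty$; repeated entries count with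
  multiplicity.\<close>

definition qpochs :: "complex list \<Rightarrow> complex \<Rightarrow> complex" where
  "qpochs as q = (\<Prod>a\<leftarrow>as. qpoch a q)"

definition dirichlet_character :: "nat \<Rightarrow> (int \<Rightarrow> complex) \<Rightarrow> bool" where
  "dirichlet_character n \<psi> \<longleftrightarrow>
     n > 0 \<and> \<psi> 1 = 1 \<and>
     (\<forall>a b. \<psi> (a * b) = \<psi> a * \<psi> b) \<and>
     (\<forall>a. \<psi> (a + int n) = \<psi> a) \<and>
     (\<forall>a. \<psi> a = 0 \<longleftrightarrow> \<not> coprime a (int n))"

definition primitive_character :: "nat \<Rightarrow> (int \<Rightarrow> complex) \<Rightarrow> bool" where
  "primitive_character n \<psi> \<longleftrightarrow>
     dirichlet_character n \<psi> \<and>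
     \<not> (\<exists>d \<phi>. d dvd n \<and> d < n \<and> dirichlet_character d \<phi> \<and>
            (\<forall>a. coprime a (int n) \<longrightarrow> \<psi> a = \<phi> a))"

definition odd_character :: "(int \<Rightarrow> complex) \<Rightarrow> bool" where
  "odd_character \<psi> \<longleftrightarrow> \<psi> (-1) = -1"

definition dirichlet_L_series :: "(int \<Rightarrow> complex) \<Rightarrow> complex \<Rightarrow> complex" where
  "dirichlet_L_series \<psi> s = (\<Sum>n. \<psi> (int (Suc n)) * of_nat (Suc n) powr (-s))"

text \<open>The entire function that continues the Dirichlet series from its half-plane of absolute
  convergence. It is unique by the identity theorem, and it exists for every non-principal
  character, in particular for every odd one. For principal characters (pole at 1) the
  description below is not meaningful.\<close>

definition dirichlet_L :: "(int \<Rightarrow> complex) \<Rightarrow> complex \<Rightarrow> complex" where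
  "dirichlet_L \<psi> =
     (THE f. f holomorphic_on UNIV \<and> (\<forall>s. Re s > 1 \<longrightarrow> f s = dirichlet_L_series \<psi> s))"

definition nome :: "complex \<Rightarrow> complex" where
  "nome \<tau> = exp (2 * of_real pi * \<i> * \<tau>)"

definition eisenstein1 :: "(int \<Rightarrow> complex) \<Rightarrow> complex \<Rightarrow> complex" where
  "eisenstein1 \<psi> \<tau> =
     1 + 2 / dirichlet_L \<psi> 0 *
       (\<Sum>n. \<psi> (int (Suc n)) * (nome \<tau> ^ Suc n / (1 - nome \<tau> ^ Suc n)))"

definition eisenstein_mean :: "nat \<Rightarrow> complex \<Rightarrow> complex" where
  "eisenstein_mean p \<tau> =
     2 / (of_nat p - 1) *
       (\<Sum>\<psi> | primitive_character p \<psi> \<and> odd_character \<psi>. eisenstein1 \<psi> \<tau>)"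

end

theory Submission
  imports Defs "HOL-Number_Theory.Number_Theory"
begin

text \<open>
  Write $g(n) = q^n/(1-q^n)$ and let $\theta$ be the theta function $(z, q^p/z; q^p)_\infty$. All six
  products are instances $(i,j,k) = (1,1,1)$, $(1,1,2)$, $(1,2,3)$, $(1,3,4)$, $(2,3,5)$, $(3,4,5)$ of
  \[ (q^p;q^p)_\infty^2\, \frac{\theta(q^{i+j})\theta(q^{i+k})\theta(q^{j+k})}
     {\theta(q^i)\theta(q^j)\theta(q^k)\theta(q^{i+j+k})}. \]
  By the classical addition formula that expresses $\zeta(a)+\zeta(b)+\zeta(c)-\zeta(a+b+c)$ as a
  quotient of theta functions (Liouville's theorem in one of the variables), this quotient is
  $1 + \sum_n c(n) g(n)$, where $c$ is the odd function modulo $p$ that is the signed indicator of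
  $i, j, k, -(i+j+k)$.

  On the other side, $L(0,\chi) = -\frac1p\sum_m m\chi(m)$. The triples are chosen such that
  $im + jm + km - (i+j+k)m$, each term reduced modulo $p$, equals $p$ for all $m \not\equiv 0, \pm 1$;
  summing this against $\chi$ gives
  $2/L(0,\chi) = \bar\chi(i)+\bar\chi(j)+\bar\chi(k)-\bar\chi(i+j+k)$, and the orthogonality of the odd
  characters turns the mean of the Eisenstein series into $1 + \sum_n c(n) g(n)$.
\<close>

section \<open>Entire functions with common quasi-periods\<close>

text \<open>The obstacle on the character side is that \<open>dirichlet_L\<close> describes an
  entire function, so its value at 0 is accessible only after an entire continuation has been built.
  Repeated summation by parts does this: a periodic sequence with sum 0 over a period has periodic
  partial sums, subtracting their mean restores the sum 0, and each round gains one power of n in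
  the decay. At s = 0 only the first mean survives.

  The condition on the triples comes from r*m mod p = r*m - p*floor(r*m/p). It says that
  floor((i+j+k)*m/p) - floor(i*m/p) - floor(j*m/p) - floor(k*m/p) is 1 for 1 < m < p-1; the values 0
  at m = 1 and 2 at m = p-1 are forced by i+j+k < p. A constant is invisible to an odd character, so
  the deviations at the two ends alone determine the sum.

  On the theta side all zeros are simple and lie on one lattice, so comparing two sides takes only
  finitely many evaluations.\<close>

lemma holomorphic_dvd_if_simple_zeros:
  fixes f g :: "complex \<Rightarrow> complex"
  assumes f: "f holomorphic_on UNIV" and g: "g holomorphic_on UNIV"
    and simple: "\<And>w. g w = 0 \<Longrightarrow> f w = 0 \<and> deriv g w \<noteq> 0"
  obtains h where "h holomorphic_on UNIV" "\<And>w. f w = h w * g w"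
proof -
  define h where "h w = (if g w = 0 then deriv f w / deriv g w else f w / g w)" for w
  have "h field_differentiable at a" for a
  proof (cases "g a = 0")
    case False
    have "isCont g a" using g by (simp add: holomorphic_on_imp_continuous_on continuous_on_eq_continuous_at
          open_UNIV holomorphic_on_imp_differentiable_at field_differentiable_imp_continuous_at)
    then have ev: "\<forall>\<^sub>F w in nhds a. f w / g w = h w"
      using False continuous_at_avoid[of a g 0] unfolding h_def
      by (auto simp: eventually_nhds_metric dist_commute)
    have "(\<lambda>w. f w / g w) field_differentiable at a"
      using False f g holomorphic_on_imp_differentiable_at open_UNIV
      by (intro field_differentiable_divide) auto
    then show ?thesis
      using ev by (metis DERIV_cong_ev field_differentiable_def)
  next
    case True
    \<comment> \<open>Dividing by w - a removes the common zero: \<open>f1\<close> and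
      \<open>g1\<close> are entire, and \<open>g1 a\<close> is the nonzero derivative of
      \<open>g\<close> at \<open>a\<close>. So \<open>f1 / g1\<close> is regular at \<open>a\<close>
      and takes there the value that \<open>h\<close> prescribes.\<close>
    define f1 where "f1 w = (if w = a then deriv f a else (f w - f a) / (w - a))" for w
    define g1 where "g1 w = (if w = a then deriv g a else (g w - g a) / (w - a))" for w
    have f1: "f1 holomorphic_on UNIV" and g1: "g1 holomorphic_on UNIV"
      unfolding f1_def g1_def using pole_lemma_open f g open_UNIV by blast+
    have ga: "g1 a \<noteq> 0" "f a = 0" using simple[OF True] by (auto simp: g1_def)
    have "isCont g1 a" using g1 by (simp add: 
          open_UNIV holomorphic_on_imp_differentiable_at field_differentiable_imp_continuous_at)
    then obtain e where e: "e > 0" "\<And>w. dist a w < e \<Longrightarrow> g1 w \<noteq> 0"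
      using continuous_at_avoid[of a g1 0] ga by auto
    have eq: "f1 w / g1 w = h w" if "dist a w < e" for w
      using e(2)[OF that] True ga by (auto simp: f1_def g1_def h_def)
    have ev: "\<forall>\<^sub>F w in nhds a. f1 w / g1 w = h w"
      using eq e(1) by (auto simp: eventually_nhds_metric dist_commute)
    have "(\<lambda>w. f1 w / g1 w) field_differentiable at a"
      using ga f1 g1 holomorphic_on_imp_differentiable_at open_UNIV
      by (intro field_differentiable_divide) auto
    then show ?thesis
      using ev by (metis DERIV_cong_ev field_differentiable_def)
  qed
  then have "h holomorphic_on UNIV"
    by (simp add: holomorphic_on_def field_differentiable_at_within)
  moreover have "f w = h w * g w" for w
    using simple[of w] by (auto simp: h_def)
  ultimately show thesis by (rule that)
qed

text \<open>Where \<open>h\<close> is nonzero it stays nonzero nearby, which forces \<open>g\<close>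
  to vanish on a neighbourhood, against the simplicity of its zeros. This cancels \<open>g\<close>
  from an identity even at the points where \<open>g\<close> vanishes.\<close>

lemma holomorphic_mult_eq_0:
  fixes h g :: "complex \<Rightarrow> complex"
  assumes h: "h holomorphic_on UNIV" and g: "g holomorphic_on UNIV"
    and simple: "\<And>w. g w = 0 \<Longrightarrow> deriv g w \<noteq> 0"
    and eq: "\<And>w. h w * g w = 0"
  shows "h w = 0"
proof (rule ccontr)
  assume nz: "h w \<noteq> 0"
  have "isCont h w" using h by (simp add: 
          open_UNIV holomorphic_on_imp_differentiable_at field_differentiable_imp_continuous_at)
  then obtain e where e: "e > 0" "\<And>v. dist w v < e \<Longrightarrow> h v \<noteq> 0"
    using continuous_at_avoid[of w h 0] nz by auto
  have "\<forall>\<^sub>F v in nhds w. g v = 0"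
    using e eq by (auto simp: eventually_nhds_metric dist_commute)
  then have "deriv g w = deriv (\<lambda>_. 0) w" by (intro deriv_cong_ev) auto
  moreover have "g w = 0" using eq[of w] nz by simp
  ultimately show False using simple by simp
qed

text \<open>The codomain is arbitrary so that predicates are covered too: for a quasi-periodic
  \<open>f\<close> with nonvanishing multiplier, the truth value of \<open>f w = 0\<close> is
  periodic.\<close>

lemma periodic_int:
  fixes h :: "complex \<Rightarrow> 'a"
  assumes "\<And>w. h (w + t) = h w"
  shows "h (w + of_int n * t) = h w"
proof (induction n rule: int_induct[where k = 0])
  case (step1 i)
  then show ?case using assms[of "w + of_int i * t"] by (simp add: algebra_simps)
next
  case (step2 i)
  then show ?case using assms[of "w + of_int (i - 1) * t"] by (simp add: algebra_simps)
qed auto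

text \<open>Since \<open>Re t\<close> is nonzero, t and 2 pi i are linearly independent over the
  reals. All values of \<open>h\<close> are therefore taken on a compact period parallelogram, and
  Liouville's theorem applies.\<close>

lemma doubly_periodic_constant:
  fixes h :: "complex \<Rightarrow> complex"
  assumes h: "h holomorphic_on UNIV" and t: "Re t \<noteq> 0"
    and p1: "\<And>w. h (w + 2 * of_real pi * \<i>) = h w" and p2: "\<And>w. h (w + t) = h w"
  obtains c where "\<And>w. h w = c"
proof -
  define K where "K = (\<lambda>(x, y). of_real x * t + of_real y * (2 * of_real pi * \<i>)) ` ({0..1} \<times> {0..1::real})"
  have "compact K" unfolding K_def case_prod_unfold
    by (intro compact_continuous_image compact_Times compact_Icc continuous_intros)
  then have "compact (h ` K)"
    using h by (intro compact_continuous_image holomorphic_on_imp_continuous_on) (auto intro: holomorphic_on_subset)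
  then have bd: "bounded (h ` K)" by (rule compact_imp_bounded)
  have "h w \<in> h ` K" for w
  proof -
    \<comment> \<open>These are the real coordinates of \<open>w\<close> in the basis t, 2 pi i; as
      2 pi i is purely imaginary, the real part alone determines \<open>x\<close>.\<close>
    define x where "x = Re w / Re t"
    define y where "y = (Im w - x * Im t) / (2 * pi)"
    have w: "w = of_real x * t + of_real y * (2 * of_real pi * \<i>)"
      using t by (simp add: complex_eq_iff x_def y_def)
    define v where "v = of_real (frac x) * t + of_real (frac y) * (2 * of_real pi * \<i>)"
    have "v \<in> K" unfolding K_def v_def
      by (rule image_eqI[where x = "(frac x, frac y)"]) (auto simp: frac_lt_1 less_imp_le)
    moreover have "w = v + of_int \<lfloor>x\<rfloor> * t + of_int \<lfloor>y\<rfloor> * (2 * of_real pi * \<i>)"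
      unfolding w v_def frac_def by (simp add: algebra_simps)
    then have "h w = h v" using periodic_int[of h, OF p1] periodic_int[of h, OF p2] by metis
    ultimately show ?thesis by auto
  qed
  then have "bounded (range h)" using bd by (metis bounded_subset image_subsetI)
  with h have "h constant_on UNIV" by (rule Liouville_theorem)
  then show thesis using that unfolding constant_on_def by auto
qed

text \<open>The quotient f/g is entire, and the common multiplier \<open>\<kappa>\<close> cancels in
  it, so it is doubly periodic and hence constant. Both periodicities are proved after
  multiplication by \<open>g\<close>, because division fails at the zeros of
  \<open>g\<close>.\<close>

lemma quasi_periodic_proportional:
  fixes f g \<kappa> :: "complex \<Rightarrow> complex"
  assumes f: "f holomorphic_on UNIV" and g: "g holomorphic_on UNIV" and t: "Re t \<noteq> 0"
    and f1: "\<And>w. f (w + 2 * of_real pi * \<i>) = f w" and g1: "\<And>w. g (w + 2 * of_real pi * \<i>) = g w"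
    and f2: "\<And>w. f (w + t) = \<kappa> w * f w" and g2: "\<And>w. g (w + t) = \<kappa> w * g w"
    and \<kappa>: "\<And>w. \<kappa> w \<noteq> 0"
    and simple: "\<And>w. g w = 0 \<Longrightarrow> f w = 0 \<and> deriv g w \<noteq> 0"
  obtains c where "\<And>w. f w = c * g w"
proof -
  obtain h where h: "h holomorphic_on UNIV" and eq: "\<And>w. f w = h w * g w"
    using holomorphic_dvd_if_simple_zeros[OF f g simple] by metis
  have shift: "(\<lambda>w. h (w + c)) holomorphic_on UNIV" for c
    using holomorphic_on_compose_gen[OF _ h, of "\<lambda>w. w + c" UNIV] holomorphic_on_add[OF holomorphic_on_ident holomorphic_on_const]
    by (simp add: o_def)
  have "h (w + 2 * of_real pi * \<i>) - h w = 0" for w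
    using f1 g1 eq simple
    by (intro holomorphic_mult_eq_0[of "\<lambda>w. h (w + 2 * of_real pi * \<i>) - h w" g] holomorphic_intros shift h g)
       (auto simp: algebra_simps)
  moreover have "h (w + t) - h w = 0" for w
  proof (rule holomorphic_mult_eq_0[of "\<lambda>w. h (w + t) - h w" g])
    fix w
    have "\<kappa> w * (h (w + t) * g w) = h (w + t) * g (w + t)" by (simp add: g2)
    also have "\<dots> = f (w + t)" by (rule eq[symmetric])
    also have "\<dots> = \<kappa> w * (h w * g w)" by (simp only: f2 eq[of w])
    finally have "\<kappa> w * (h (w + t) * g w) = \<kappa> w * (h w * g w)" .
    then show "(h (w + t) - h w) * g w = 0" using \<kappa>[of w] by (metis eq_iff_diff_eq_0 left_diff_distrib mult_left_cancel)
  qed (use simple in \<open>auto intro!: holomorphic_intros shift h g\<close>)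
  ultimately obtain c where "\<And>w. h w = c"
    using doubly_periodic_constant[OF h t] by (metis eq_iff_diff_eq_0)
  then show thesis using that eq by auto
qed

section \<open>The theta function\<close>

context
  fixes q :: complex
  assumes q: "norm q < 1"
begin

lemma abs_convergent_qpoch: "abs_convergent_prod (\<lambda>j. 1 - a * q ^ j)"
  using q by (intro summable_imp_abs_convergent_prod)
    (simp add: norm_mult norm_power summable_mult)

lemma qpoch_LIMSEQ: "(\<lambda>n. \<Prod>j<n. 1 - a * q ^ j) \<longlonglongrightarrow> qpoch a q"
proof -
  have "(\<lambda>n. \<Prod>j\<le>n. 1 - a * q ^ j) \<longlonglongrightarrow> qpoch a q"
    unfolding qpoch_def
    by (intro convergent_prod_LIMSEQ abs_convergent_prod_imp_convergent_prod abs_convergent_qpoch)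
  then show ?thesis by (simp add: LIMSEQ_lessThan_iff_atMost)
qed

lemma qpoch_eq_0_iff: "qpoch a q = 0 \<longleftrightarrow> (\<exists>j. a * q ^ j = 1)"
proof
  assume "qpoch a q = 0"
  then show "\<exists>j. a * q ^ j = 1"
    using prodinf_nonzero[OF abs_convergent_prod_imp_convergent_prod[OF abs_convergent_qpoch[of a]]]
    unfolding qpoch_def by auto
next
  assume "\<exists>j. a * q ^ j = 1"
  then obtain j where j: "a * q ^ j = 1" by blast
  have "\<forall>\<^sub>F n in sequentially. (\<Prod>i<n. 1 - a * q ^ i) = 0"
    using eventually_gt_at_top[of j] by eventually_elim (use j in auto)
  then have "(\<lambda>n. \<Prod>i<n. 1 - a * q ^ i) \<longlonglongrightarrow> 0" by (rule tendsto_eventually)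
  then show "qpoch a q = 0" using qpoch_LIMSEQ LIMSEQ_unique by blast
qed

lemma qpoch_split_head: "qpoch a q = (1 - a) * qpoch (a * q) q"
proof -
  have "(\<lambda>n. \<Prod>j<Suc n. 1 - a * q ^ j) \<longlonglongrightarrow> qpoch a q"
    using qpoch_LIMSEQ LIMSEQ_Suc by blast
  moreover have "(\<lambda>n. \<Prod>j<Suc n. 1 - a * q ^ j) = (\<lambda>n. (1 - a) * (\<Prod>j<n. 1 - a * q * q ^ j))"
    by (simp add: prod.lessThan_Suc_shift mult_ac del: prod.lessThan_Suc)
  moreover have "(\<lambda>n. (1 - a) * (\<Prod>j<n. 1 - a * q * q ^ j)) \<longlonglongrightarrow> (1 - a) * qpoch (a * q) q"
    by (intro tendsto_intros qpoch_LIMSEQ)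
  ultimately show ?thesis by (metis LIMSEQ_unique)
qed

text \<open>Local uniformity in \<open>a\<close> is what makes \<open>qpoch\<close> holomorphic in
  its first argument and what justifies the termwise logarithmic derivative.\<close>

lemma uniform_limit_qpoch:
  assumes "compact K"
  shows "uniform_limit K (\<lambda>n a. \<Prod>j<n. 1 - a * q ^ j) (\<lambda>a. qpoch a q) sequentially"
proof -
  obtain B where B: "\<And>a. a \<in> K \<Longrightarrow> norm a \<le> B"
    using assms compact_imp_bounded bounded_iff by metis
  have "uniformly_convergent_on K (\<lambda>n a. \<Sum>j<n. norm ((1 - a * q ^ j) - 1))"
  proof (rule Weierstrass_m_test')
    show "norm (norm ((1 - a * q ^ j) - 1)) \<le> B * norm q ^ j" if "a \<in> K" for a j
      using B[OF that] by (simp add: norm_mult norm_power mult_right_mono)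
    show "summable (\<lambda>j. B * norm q ^ j)" using q by (intro summable_mult summable_geometric) auto
  qed
  then have "uniformly_convergent_on K (\<lambda>n a. \<Prod>j<n. 1 - a * q ^ j)"
    by (intro uniformly_convergent_on_prod' assms continuous_intros)
  then obtain l where l: "uniform_limit K (\<lambda>n a. \<Prod>j<n. 1 - a * q ^ j) l sequentially"
    unfolding uniformly_convergent_on_def by blast
  have "l a = qpoch a q" if "a \<in> K" for a
    using tendsto_uniform_limitI[OF l that] qpoch_LIMSEQ LIMSEQ_unique by blast
  then show ?thesis
    using l uniform_limit_cong'[of K "\<lambda>n a. \<Prod>j<n. 1 - a * q ^ j" "\<lambda>n a. \<Prod>j<n. 1 - a * q ^ j" l "\<lambda>a. qpoch a q" sequentially]
    by simp
qed

lemma holomorphic_qpoch: "(\<lambda>a. qpoch a q) holomorphic_on UNIV"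
proof (rule holomorphic_uniform_sequence)
  show "(\<lambda>a. \<Prod>j<n. 1 - a * q ^ j) holomorphic_on UNIV" for n
    by (intro holomorphic_intros)
  show "\<exists>d>0. cball x d \<subseteq> UNIV \<and>
      uniform_limit (cball x d) (\<lambda>n a. \<Prod>j<n. 1 - a * q ^ j) (\<lambda>a. qpoch a q) sequentially" for x
    by (intro exI[of _ 1]) (auto intro: uniform_limit_qpoch)
qed auto

lemma logderiv_qpoch:
  assumes "qpoch a q \<noteq> 0"
  shows "(\<lambda>j. - (q ^ j / (1 - a * q ^ j))) sums (deriv (\<lambda>a. qpoch a q) a / qpoch a q)"
proof -
  have "(\<lambda>j. deriv (\<lambda>a. 1 - a * q ^ j) a / (1 - a * q ^ j)) sums (deriv (\<lambda>a. qpoch a q) a / qpoch a q)"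
  proof (rule logderiv_prodinf_complex_uniform_limit)
    show "uniform_limit (ball a 1) (\<lambda>n a. \<Prod>j<n. 1 - a * q ^ j) (\<lambda>a. qpoch a q) sequentially"
      by (rule uniform_limit_on_subset[OF uniform_limit_qpoch[of "cball a 1"]]) auto
    show "(\<lambda>a. 1 - a * q ^ j) holomorphic_on ball a 1" for j by (intro holomorphic_intros)
  qed (use assms in auto)
  moreover have "deriv (\<lambda>a. 1 - a * q ^ j) a = - (q ^ j)" for j
    by (rule DERIV_imp_deriv) (auto intro!: derivative_eq_intros)
  ultimately show ?thesis by simp
qed

end

text \<open>With $z = e^w$ and $Q = e^t$, \<^term>\<open>theta t w\<close> is $(z, Q/z; Q)_\infty$. The logarithmic
  coordinates make it entire and quasi-periodic.\<close>

definition theta :: "complex \<Rightarrow> complex \<Rightarrow> complex" where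
  "theta t w = qpoch (exp w) (exp t) * qpoch (exp (t - w)) (exp t)"

context
  fixes t :: complex
  assumes t: "Re t < 0"
begin

lemma norm_exp_t: "norm (exp t) < 1"
  using t by simp

lemma holomorphic_qpoch_compose:
  assumes "f holomorphic_on UNIV"
  shows "(\<lambda>w. qpoch (f w) (exp t)) holomorphic_on UNIV"
  using holomorphic_on_compose_gen[OF assms holomorphic_qpoch[OF norm_exp_t]] by (simp add: o_def)

lemma holomorphic_theta: "theta t holomorphic_on UNIV"
  unfolding theta_def by (intro holomorphic_intros holomorphic_qpoch_compose)

lemma holomorphic_theta_shift: "(\<lambda>w. theta t (w + s)) holomorphic_on UNIV"
  using holomorphic_on_compose_gen[OF _ holomorphic_theta, of "\<lambda>w. w + s" UNIV] holomorphic_on_add[OF holomorphic_on_ident holomorphic_on_const]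
  by (simp add: o_def)

lemma theta_plus_2pi: "theta t (w + 2 * of_real pi * \<i>) = theta t w"
proof -
  have "exp (w + 2 * of_real pi * \<i>) = exp w" by (simp add: exp_add)
  moreover have "exp (t - (w + 2 * of_real pi * \<i>)) = exp (t - w)"
    by (simp add: exp_diff exp_add)
  ultimately show ?thesis by (simp add: theta_def)
qed

text \<open>The two remaining \<open>qpoch\<close> factors are interchanged by w -> -w, so the
  reflection formula and the derivative at 0 depend on the factor \<open>1 - exp w\<close>
  alone.\<close>

lemma theta_split:
  "theta t w = (1 - exp w) * qpoch (exp (w + t)) (exp t) * qpoch (exp (t - w)) (exp t)"
  using qpoch_split_head[OF norm_exp_t, of "exp w"] by (simp add: theta_def exp_add)

lemma theta_uminus: "theta t (- w) = - exp (- w) * theta t w"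
  unfolding theta_split by (simp add: exp_minus field_simps add.commute)

lemma theta_plus_t: "theta t (w + t) = - exp (- w) * theta t w"
proof -
  have "qpoch (exp (- w)) (exp t) = (1 - exp (- w)) * qpoch (exp (t - w)) (exp t)"
    using qpoch_split_head[OF norm_exp_t, of "exp (- w)"] by (simp flip: exp_add)
  then have "theta t (w + t) = qpoch (exp (w + t)) (exp t) * ((1 - exp (- w)) * qpoch (exp (t - w)) (exp t))"
    by (simp add: theta_def)
  moreover have "1 - exp (- w) = - exp (- w) * (1 - exp w)"
    by (simp add: algebra_simps flip: exp_add)
  ultimately show ?thesis by (simp add: theta_split[of w])
qed

text \<open>The first product in \<open>theta\<close> supplies the zeros with n <= 0, the second
  those with n >= 1; together they form the lattice spanned by t and 2 pi i.\<close>

lemma theta_eq_0_iff: "theta t w = 0 \<longleftrightarrow> (\<exists>n::int. exp w = exp (of_int n * t))"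
proof
  assume "theta t w = 0"
  then consider j where "exp w * exp t ^ j = 1" | j where "exp (t - w) * exp t ^ j = 1"
    unfolding theta_def using qpoch_eq_0_iff[OF norm_exp_t] by auto
  then show "\<exists>n::int. exp w = exp (of_int n * t)"
  proof cases
    case 1
    then have "exp w = exp (of_int (- int j) * t)"
      by (simp add: exp_minus field_simps flip: exp_of_nat2_mult)
    then show ?thesis by blast
  next
    case 2
    then have "exp w = exp (of_int (1 + int j) * t)"
      by (simp add: exp_diff ring_distribs exp_add exp_of_nat2_mult field_simps)
    then show ?thesis by blast
  qed
next
  assume "\<exists>n::int. exp w = exp (of_int n * t)"
  then obtain n :: int where n: "exp w = exp (of_int n * t)" by blast
  show "theta t w = 0"
  proof (cases "n \<le> 0")
    case True
    then have "exp w * exp t ^ nat (- n) = 1"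
      by (simp add: n flip: exp_of_nat_mult exp_add)
    then show ?thesis
      unfolding theta_def using qpoch_eq_0_iff[OF norm_exp_t] by auto
  next
    case False
    then have "exp (t - w) * exp t ^ nat (n - 1) = 1"
      by (simp add: n exp_diff field_simps flip: exp_of_nat_mult exp_add)
    then show ?thesis
      unfolding theta_def using qpoch_eq_0_iff[OF norm_exp_t] by auto
  qed
qed

text \<open>This serves to carry the simple zero at 0 to every point n*t. The constant is left
  existential, as its being nonzero is enough for that.\<close>

lemma theta_plus_int:
  "\<exists>c. c \<noteq> 0 \<and> (\<forall>w. theta t (w + of_int n * t) = c * exp (- of_int n * w) * theta t w)"
proof (induction n rule: int_induct[where k = 0])
  case base
  show ?case by (intro exI[of _ 1]) auto
next
  case (step1 i)
  then obtain c where c: "c \<noteq> 0" "\<And>w. theta t (w + of_int i * t) = c * exp (- of_int i * w) * theta t w"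
    by blast
  have "theta t (w + of_int (i + 1) * t) = (- c * exp (- of_int i * t)) * exp (- of_int (i + 1) * w) * theta t w" for w
  proof -
    have "theta t (w + of_int (i + 1) * t) = - (exp (- (w + of_int i * t)) * exp (- of_int i * w)) * c * theta t w"
      using theta_plus_t[of "w + of_int i * t"] c(2)[of w] by (simp add: algebra_simps)
    also have "exp (- (w + of_int i * t)) * exp (- of_int i * w) = exp (- of_int i * t) * exp (- of_int (i + 1) * w)"
      by (simp add: algebra_simps flip: exp_add)
    finally show ?thesis by (simp add: algebra_simps)
  qed
  then show ?case using c(1) by (intro exI[of _ "- c * exp (- of_int i * t)"]) auto
next
  case (step2 i)
  then obtain c where c: "c \<noteq> 0" "\<And>w. theta t (w + of_int i * t) = c * exp (- of_int i * w) * theta t w"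
    by blast
  have "theta t (w + of_int (i - 1) * t) = (- c * exp (of_int (i - 1) * t)) * exp (- of_int (i - 1) * w) * theta t w" for w
  proof -
    have "theta t (w + of_int (i - 1) * t) = - exp (w + of_int (i - 1) * t) * (- exp (- (w + of_int (i - 1) * t)) * theta t (w + of_int (i - 1) * t))"
      by (simp only: exp_minus) simp
    also have "\<dots> = - exp (w + of_int (i - 1) * t) * theta t (w + of_int i * t)"
      using theta_plus_t[of "w + of_int (i - 1) * t"] by (simp add: algebra_simps)
    also have "\<dots> = - exp (w + of_int (i - 1) * t) * (c * exp (- of_int i * w) * theta t w)"
      by (simp only: c(2))
    also have "\<dots> = - (exp (w + of_int (i - 1) * t) * exp (- of_int i * w)) * c * theta t w" by simp
    also have "exp (w + of_int (i - 1) * t) * exp (- of_int i * w) = exp (of_int (i - 1) * t) * exp (- of_int (i - 1) * w)"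
      by (simp add: algebra_simps flip: exp_add)
    finally show ?thesis by (simp add: algebra_simps)
  qed
  then show ?case using c(1) by (intro exI[of _ "- c * exp (of_int (i - 1) * t)"]) auto
qed

lemma has_deriv_theta [derivative_intros]:
  "(f has_field_derivative f') (at x within A) \<Longrightarrow>
   ((\<lambda>x. theta t (f x)) has_field_derivative deriv (theta t) (f x) * f') (at x within A)"
  by (rule DERIV_chain2) (use holomorphic_derivI[OF holomorphic_theta open_UNIV] in auto)

lemma theta_0 [simp]: "theta t 0 = 0"
  by (simp add: theta_split)

text \<open>Differentiation at 0 hits only the vanishing factor \<open>1 - exp w\<close>. The result
  is the source of the squared product in the addition formula.\<close>

lemma deriv_theta_0: "deriv (theta t) 0 = - (qpoch (exp t) (exp t) ^ 2)"
proof -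
  define F where "F w = qpoch (exp (w + t)) (exp t) * qpoch (exp (t - w)) (exp t)" for w
  have "F holomorphic_on UNIV"
    unfolding F_def by (intro holomorphic_intros holomorphic_qpoch_compose)
  then obtain F' where "(F has_field_derivative F') (at 0)"
    using holomorphic_on_imp_differentiable_at[of F UNIV 0] by (auto simp: field_differentiable_def)
  then have "((\<lambda>w. (1 - exp w) * F w) has_field_derivative - F 0) (at 0)"
    by (auto intro!: derivative_eq_intros)
  moreover have "theta t = (\<lambda>w. (1 - exp w) * F w)"
    by (auto simp: theta_split F_def)
  ultimately show ?thesis by (auto simp: F_def power2_eq_square intro!: DERIV_imp_deriv)
qed

lemma deriv_theta_0_nonzero: "deriv (theta t) 0 \<noteq> 0"
proof -
  have "exp t * exp t ^ j \<noteq> 1" for j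
    using power_less_one_iff[of "norm (exp t)" "Suc j"] norm_exp_t
    by (metis less_irrefl norm_ge_zero norm_one norm_power power_Suc zero_less_Suc)
  then show ?thesis using qpoch_eq_0_iff[OF norm_exp_t, of "exp t"] by (simp add: deriv_theta_0)
qed

lemma deriv_theta_plus_2pi: "deriv (theta t) (w + 2 * of_real pi * \<i>) = deriv (theta t) w"
proof -
  have "((\<lambda>w. theta t (w + 2 * of_real pi * \<i>)) has_field_derivative deriv (theta t) (w + 2 * of_real pi * \<i>)) (at w)"
    by (auto intro!: derivative_eq_intros)
  then show ?thesis by (simp add: theta_plus_2pi DERIV_imp_deriv)
qed

lemma deriv_theta_plus_t:
  "deriv (theta t) (w + t) = - exp (- w) * (deriv (theta t) w - theta t w)"
proof -
  have "((\<lambda>w. theta t (w + t)) has_field_derivative deriv (theta t) (w + t)) (at w)"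
    by (auto intro!: derivative_eq_intros)
  moreover have "((\<lambda>w. - exp (- w) * theta t w) has_field_derivative
      - exp (- w) * (deriv (theta t) w - theta t w)) (at w)"
    by (auto intro!: derivative_eq_intros simp: algebra_simps)
  ultimately show ?thesis by (simp add: theta_plus_t DERIV_unique)
qed

lemma deriv_theta_uminus:
  "deriv (theta t) (- w) = exp (- w) * (deriv (theta t) w - theta t w)"
proof -
  have "((\<lambda>w. theta t (- w)) has_field_derivative - deriv (theta t) (- w)) (at w)"
    by (auto intro!: derivative_eq_intros)
  moreover have "((\<lambda>w. - exp (- w) * theta t w) has_field_derivative
      - exp (- w) * (deriv (theta t) w - theta t w)) (at w)"
    by (auto intro!: derivative_eq_intros simp: algebra_simps)
  ultimately have "- deriv (theta t) (- w) = - exp (- w) * (deriv (theta t) w - theta t w)"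
    unfolding theta_uminus by (rule DERIV_unique)
  then show ?thesis by simp
qed

text \<open>A zero is a lattice point, and the zero at 0 is simple. Differentiating the translation
  law at 0 transports this: the derivative of the exponential factor is multiplied by
  \<open>theta t 0\<close>, which is 0.\<close>

lemma theta_simple_zeros:
  assumes "theta t w = 0"
  shows "deriv (theta t) w \<noteq> 0"
proof -
  obtain n :: int where "exp w = exp (of_int n * t)" using assms theta_eq_0_iff by blast
  then obtain m :: int where m: "w = of_int n * t + of_int (2 * m) * of_real pi * \<i>"
    unfolding exp_eq by auto
  obtain c where c: "c \<noteq> 0" "\<And>w. theta t (w + of_int n * t) = c * exp (- of_int n * w) * theta t w"
    using theta_plus_int by blast
  have "((\<lambda>w. c * exp (- of_int n * w) * theta t w) has_field_derivative c * deriv (theta t) 0) (at 0)"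
    by (auto intro!: derivative_eq_intros)
  moreover have "((\<lambda>w. theta t (w + of_int n * t)) has_field_derivative deriv (theta t) (of_int n * t)) (at 0)"
    by (auto intro!: derivative_eq_intros)
  ultimately have "deriv (theta t) (of_int n * t) = c * deriv (theta t) 0"
    by (simp add: c(2) DERIV_unique)
  moreover have "deriv (theta t) (of_int n * t + of_int m * (2 * of_real pi * \<i>)) = deriv (theta t) (of_int n * t)"
    by (rule periodic_int) (rule deriv_theta_plus_2pi)
  ultimately show ?thesis using c(1) deriv_theta_0_nonzero m by (simp add: algebra_simps)
qed

end

section \<open>The addition formula for logarithmic derivatives of theta\<close>

lemma quasi_periodic_zero_iff:
  fixes f :: "complex \<Rightarrow> complex"
  assumes "\<And>w. f (w + 2 * of_real pi * \<i>) = f w" and "\<And>w. f (w + t) = \<kappa> w * f w" and "\<And>w. \<kappa> w \<noteq> 0"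
    and "exp w = exp (of_int n * t)"
  shows "f (w + v) = 0 \<longleftrightarrow> f v = 0"
proof -
  obtain m :: int where m: "w = of_int n * t + of_int (2 * m) * of_real pi * \<i>"
    using assms(4) unfolding exp_eq by auto
  have "f (v + of_int n * t + of_int m * (2 * of_real pi * \<i>)) = f (v + of_int n * t)"
    by (rule periodic_int) (rule assms)
  moreover have "(f (v + of_int n * t) = 0) = (f v = 0)"
    by (rule periodic_int[of "\<lambda>w. f w = 0"]) (simp add: assms)
  ultimately show ?thesis by (simp add: m algebra_simps)
qed

text \<open>The function exp(-w/2) times \<open>theta t w\<close> is odd, so \<open>L\<close> is 1/2
  plus an odd function. The leading 1 compensates the total 3/2 - 1/2 of these constants.\<close>

lemma theta_four_term:
  fixes a b c t :: complex
  assumes t: "Re t < 0"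
    and nz: "theta t a \<noteq> 0" "theta t b \<noteq> 0" "theta t c \<noteq> 0" "theta t (a + b) \<noteq> 0" "theta t (a + b + c) \<noteq> 0"
  defines "L \<equiv> \<lambda>w. deriv (theta t) w / theta t w"
  shows "1 - L a - L b - L c + L (a + b + c) =
    qpoch (exp t) (exp t) ^ 2 * theta t (a + b) * theta t (a + c) * theta t (b + c) /
      (theta t a * theta t b * theta t c * theta t (a + b + c))"
proof -
  txt \<open>Multiplied by $\theta(w)\theta(w+a+b)$, the difference of the two sides as a function of
    $w = c$ is \<open>f\<close>, up to a constant that is determined at $w = -a$.\<close>
  define s where "s = a + b"
  \<comment> \<open>The value of \<open>K\<close> is dictated by f(0) = 0; the vanishing at -s then
    follows from the reflection formula.\<close>
  define K where "K = deriv (theta t) 0 * theta t s / (theta t a * theta t b)"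
  define f where "f w = deriv (theta t) w * theta t (w + s) - theta t w * deriv (theta t) (w + s)
    - K * theta t (w + a) * theta t (w + b)" for w
  define g where "g w = theta t w * theta t (w + s)" for w
  define \<kappa> where "\<kappa> w = exp (- w) * exp (- (w + s))" for w
  note hol = holomorphic_theta[OF t] holomorphic_theta_shift[OF t]
  have shift: "x + 2 * of_real pi * \<i> + y = (x + y) + 2 * of_real pi * \<i>" "x + t + y = (x + y) + t" for x y
    by (simp_all add: algebra_simps)
  have deriv_shift: "(\<lambda>w. deriv (theta t) (w + s)) holomorphic_on UNIV"
    using holomorphic_on_compose_gen[OF _ holomorphic_deriv[OF holomorphic_theta[OF t] open_UNIV], of "\<lambda>w. w + s" UNIV]
      holomorphic_on_add[OF holomorphic_on_ident holomorphic_on_const]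
    by (simp add: o_def)
  have f: "f holomorphic_on UNIV"
    unfolding f_def by (intro holomorphic_intros deriv_shift hol holomorphic_deriv open_UNIV)
  have g: "g holomorphic_on UNIV"
    unfolding g_def by (intro holomorphic_intros hol)
  have f1: "f (w + 2 * of_real pi * \<i>) = f w" for w
    unfolding f_def shift theta_plus_2pi[OF t] deriv_theta_plus_2pi[OF t] ..
  have g1: "g (w + 2 * of_real pi * \<i>) = g w" for w
    unfolding g_def shift theta_plus_2pi[OF t] ..
  \<comment> \<open>The shifts a, b and 0, s have equal sums, so both kinds of theta products
    acquire the same multiplier. In \<open>f\<close> the derivatives enter as a Wronskian, in which
    the extra terms of \<open>deriv_theta_plus_t\<close> cancel.\<close>
  have e: "exp (- (w + a)) * exp (- (w + b)) = \<kappa> w" for w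
    unfolding \<kappa>_def s_def by (simp add: algebra_simps flip: exp_add)
  have f2: "f (w + t) = \<kappa> w * f w" for w
  proof -
    have "f (w + t) = \<kappa> w * (deriv (theta t) w * theta t (w + s) - theta t w * deriv (theta t) (w + s))
        - (exp (- (w + a)) * exp (- (w + b))) * K * theta t (w + a) * theta t (w + b)"
      unfolding f_def shift theta_plus_t[OF t] deriv_theta_plus_t[OF t] \<kappa>_def
      by (simp only: algebra_simps mult_minus_left mult_minus_right minus_minus)
    then show ?thesis unfolding e f_def by (simp only: algebra_simps)
  qed
  have g2: "g (w + t) = \<kappa> w * g w" for w
    unfolding g_def shift theta_plus_t[OF t] \<kappa>_def by simp
  have \<kappa>: "\<kappa> w \<noteq> 0" for w by (simp add: \<kappa>_def)
  have d0: "deriv (theta t) 0 * theta t s = K * theta t a * theta t b"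
    using nz by (simp add: K_def)
  have f0: "f 0 = 0" unfolding f_def using d0 by (simp add: theta_0[OF t])
  have fs: "f (- s) = 0"
  proof -
    have "f (- s) = - theta t (- s) * deriv (theta t) 0 - K * theta t (- b) * theta t (- a)"
      unfolding f_def by (simp add: theta_0[OF t] s_def)
    also have "\<dots> = exp (- s) * (deriv (theta t) 0 * theta t s) - (exp (- a) * exp (- b)) * (K * theta t a * theta t b)"
      unfolding theta_uminus[OF t] by (simp only: algebra_simps mult_minus_left mult_minus_right minus_minus)
    also have "exp (- a) * exp (- b) = exp (- s)" by (simp add: s_def flip: exp_add)
    finally show ?thesis using d0 by simp
  qed
  \<comment> \<open>A common zero of the two factors of \<open>g\<close> would be a double zero of
    \<open>g\<close>. It would make s a zero of theta, which is excluded by the assumption on a +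
    b.\<close>
  have not_both: "theta t (w + s) \<noteq> 0" if "theta t w = 0" for w
  proof -
    obtain n :: int where "exp w = exp (of_int n * t)" using \<open>theta t w = 0\<close> theta_eq_0_iff[OF t] by blast
    then have "theta t (w + s) = 0 \<longleftrightarrow> theta t s = 0"
      by (intro quasi_periodic_zero_iff[where \<kappa> = "\<lambda>w. - exp (- w)"]) (simp_all add: theta_plus_2pi[OF t] theta_plus_t[OF t])
    then show ?thesis using nz by (simp add: s_def)
  qed
  have "f w = 0" if "theta t w = 0" for w
  proof -
    obtain n :: int where "exp w = exp (of_int n * t)" using \<open>theta t w = 0\<close> theta_eq_0_iff[OF t] by blast
    then show ?thesis
      using quasi_periodic_zero_iff[of f t \<kappa> w n 0] f0 by (simp add: f1 f2 \<kappa>)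
  qed
  moreover have "f w = 0" if "theta t (w + s) = 0" for w
  proof -
    obtain n :: int where "exp (w + s) = exp (of_int n * t)" using \<open>theta t (w + s) = 0\<close> theta_eq_0_iff[OF t] by blast
    then show ?thesis
      using quasi_periodic_zero_iff[of f t \<kappa> "w + s" n "- s"] fs by (simp add: f1 f2 \<kappa>)
  qed
  moreover have "deriv g w = deriv (theta t) w * theta t (w + s) + theta t w * deriv (theta t) (w + s)" for w
    unfolding g_def by (rule DERIV_imp_deriv) (auto intro!: derivative_eq_intros has_deriv_theta[OF t] simp: t)
  ultimately have simple: "f w = 0 \<and> deriv g w \<noteq> 0" if "g w = 0" for w
    using that theta_simple_zeros[OF t, of w] theta_simple_zeros[OF t, of "w + s"] not_both[of w] unfolding g_def by auto
  obtain C where C: "\<And>w. f w = C * g w"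
    using quasi_periodic_proportional[OF f g _ f1 g1 f2 g2 \<kappa> simple] t by auto
  have "C = 1 - L a - L b"
  proof -
    have "f (- a) = deriv (theta t) (- a) * theta t b - theta t (- a) * deriv (theta t) b"
      unfolding f_def by (simp add: theta_0[OF t] s_def)
    also have "\<dots> = exp (- a) * (deriv (theta t) a * theta t b - theta t a * theta t b + theta t a * deriv (theta t) b)"
      unfolding theta_uminus[OF t] deriv_theta_uminus[OF t] by (simp add: algebra_simps)
    finally have "exp (- a) * (deriv (theta t) a * theta t b - theta t a * theta t b + theta t a * deriv (theta t) b) = C * g (- a)"
      using C by simp
    also have "g (- a) = - exp (- a) * (theta t a * theta t b)"
      unfolding g_def theta_uminus[OF t] by (simp add: s_def)
    finally have "exp (- a) * (deriv (theta t) a * theta t b - theta t a * theta t b + theta t a * deriv (theta t) b)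
        = exp (- a) * (- C * (theta t a * theta t b))" by (simp only: algebra_simps mult_minus_left mult_minus_right minus_minus)
    then have "deriv (theta t) a * theta t b - theta t a * theta t b + theta t a * deriv (theta t) b = - C * (theta t a * theta t b)"
      by (rule mult_left_cancel[THEN iffD1, rotated]) simp
    then show ?thesis using nz unfolding L_def by (simp add: field_simps)
  qed
  moreover have "L c - L (c + s) - K * theta t (c + a) * theta t (c + b) / (theta t c * theta t (c + s)) = C"
    using C[of c] nz unfolding L_def f_def g_def s_def by (simp add: field_simps)
  moreover have "K * theta t (c + a) * theta t (c + b) / (theta t c * theta t (c + s)) =
     - (qpoch (exp t) (exp t) ^ 2 * theta t (a + b) * theta t (a + c) * theta t (b + c) /
      (theta t a * theta t b * theta t c * theta t (a + b + c)))"
    unfolding K_def deriv_theta_0[OF t] s_def by (simp add: field_simps)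
  moreover have "c + s = a + b + c" by (simp add: s_def)
  ultimately show ?thesis by (simp add: algebra_simps)
qed

section \<open>Lambert series as logarithmic derivatives of theta\<close>

lemma logderiv_theta:
  assumes t: "Re t < 0" and nz: "theta t w \<noteq> 0"
  shows "(\<lambda>j. exp (t - w) * exp t ^ j / (1 - exp (t - w) * exp t ^ j) - exp w * exp t ^ j / (1 - exp w * exp t ^ j))
    sums (deriv (theta t) w / theta t w)"
proof -
  define P where "P = (\<lambda>a. qpoch a (exp t))"
  have P: "(P has_field_derivative deriv P a) (at a)" for a
    unfolding P_def by (rule holomorphic_derivI[OF holomorphic_qpoch[OF norm_exp_t[OF t]] open_UNIV]) auto
  have nz': "P (exp w) \<noteq> 0" "P (exp (t - w)) \<noteq> 0"
    using nz by (auto simp: theta_def P_def)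
  have "((\<lambda>w. P (exp w) * P (exp (t - w))) has_field_derivative
      deriv P (exp w) * exp w * P (exp (t - w)) - P (exp w) * (deriv P (exp (t - w)) * exp (t - w))) (at w)"
    by (auto intro!: derivative_eq_intros DERIV_chain2[OF P])
  then have "deriv (theta t) w =
      deriv P (exp w) * exp w * P (exp (t - w)) - P (exp w) * (deriv P (exp (t - w)) * exp (t - w))"
    unfolding theta_def P_def by (rule DERIV_imp_deriv)
  then have eq: "deriv (theta t) w / theta t w =
      exp w * (deriv P (exp w) / P (exp w)) - exp (t - w) * (deriv P (exp (t - w)) / P (exp (t - w)))"
    using nz' unfolding theta_def P_def by (simp add: divide_simps)
  have *: "(\<lambda>j. a * - (exp t ^ j / (1 - a * exp t ^ j))) sums (a * (deriv P a / P a))" if "P a \<noteq> 0" for a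
    using logderiv_qpoch[OF norm_exp_t[OF t]] that unfolding P_def by (intro sums_mult)
  show ?thesis
    using sums_diff[OF *[OF nz'(1)] *[OF nz'(2)]] unfolding eq by (simp add: algebra_simps)
qed

lemma sums_residue_class:
  fixes g :: "nat \<Rightarrow> complex"
  assumes "0 < i" "i < p" and "(\<lambda>m. g (m * p + i)) sums s"
  shows "(\<lambda>n. of_bool (Suc n mod p = i) * g (Suc n)) sums s"
proof -
  \<comment> \<open>The term at index n belongs to the integer \<open>Suc n\<close>; hence the
    offset i - 1.\<close>
  define h where "h m = m * p + (i - 1)" for m
  have "strict_mono h"
  proof (rule strict_monoI)
    fix x y :: nat assume "x < y"
    then have "x * p < y * p" using assms by simp
    then show "h x < h y" using assms(1) unfolding h_def by linarith
  qed
  moreover have "of_bool (Suc n mod p = i) * g (Suc n) = 0" if "n \<notin> range h" for n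
  proof (cases "Suc n mod p = i")
    case True
    then have "n = h (Suc n div p)"
      using assms(1) div_mult_mod_eq[of "Suc n" p] unfolding h_def by linarith
    then show ?thesis using that by auto
  qed auto
  moreover have "Suc (h m) = m * p + i" for m using assms by (simp add: h_def)
  ultimately show ?thesis
    using sums_mono_reindex[of h "\<lambda>n. of_bool (Suc n mod p = i) * g (Suc n)" s] assms by simp
qed

definition residue_sign :: "nat \<Rightarrow> nat \<Rightarrow> nat \<Rightarrow> complex" where
  "residue_sign p i n = of_bool (n mod p = i) - of_bool (n mod p = p - i)"

definition theta_product :: "nat \<Rightarrow> nat \<Rightarrow> complex \<Rightarrow> complex" where
  "theta_product p i q = qpoch (q ^ i) (q ^ p) * qpoch (q ^ (p - i)) (q ^ p)"

context
  fixes q \<tau> :: complex and p :: nat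
  assumes \<tau>: "Im \<tau> > 0" and q_def: "q = nome \<tau>" and p: "p > 0"
begin

lemma norm_nome_less_1: "norm q < 1"
  using \<tau> by (simp add: q_def nome_def)

lemma exp_nome: "exp (of_nat i * (2 * of_real pi * \<i> * \<tau>)) = q ^ i"
  by (simp add: q_def nome_def exp_of_nat_mult)

lemma theta_eq_theta_product:
  assumes "i \<le> p"
  shows "theta (of_nat p * (2 * of_real pi * \<i> * \<tau>)) (of_nat i * (2 * of_real pi * \<i> * \<tau>)) = theta_product p i q"
proof -
  have "exp (of_nat p * (2 * of_real pi * \<i> * \<tau>) - of_nat i * (2 * of_real pi * \<i> * \<tau>)) = q ^ (p - i)"
    using exp_nome[of "p - i"] assms by (simp add: of_nat_diff algebra_simps)
  then show ?thesis by (simp add: theta_def theta_product_def exp_nome)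
qed

lemma nome_power_neq_1: "n > 0 \<Longrightarrow> q ^ n \<noteq> 1"
  using norm_nome_less_1 power_less_one_iff[of "norm q" n] by (metis less_irrefl norm_ge_zero norm_one norm_power)

lemma theta_product_nonzero:
  assumes "0 < i" "i < p"
  shows "theta_product p i q \<noteq> 0"
proof -
  have "norm (q ^ p) < 1" using norm_nome_less_1 p by (simp add: norm_power power_less_one_iff)
  moreover have "q ^ n * (q ^ p) ^ j \<noteq> 1" if "n > 0" for n j
    using nome_power_neq_1[of "n + p * j"] that by (simp add: power_add power_mult)
  ultimately show ?thesis using assms unfolding theta_product_def by (auto simp: qpoch_eq_0_iff)
qed

lemma lambert_logderiv_theta:
  assumes "0 < i" "i < p"
  shows "(\<lambda>n. residue_sign p i (Suc n) * (q ^ Suc n / (1 - q ^ Suc n))) sums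
    - (deriv (theta (of_nat p * (2 * of_real pi * \<i> * \<tau>))) (of_nat i * (2 * of_real pi * \<i> * \<tau>))
      / theta_product p i q)"
proof -
  define t where "t = of_nat p * (2 * of_real pi * \<i> * \<tau>)"
  define w where "w = of_nat i * (2 * of_real pi * \<i> * \<tau>)"
  define g where "g n = q ^ n / (1 - q ^ n)" for n
  have t: "Re t < 0" using \<tau> p by (simp add: t_def)
  have \<theta>: "theta t w = theta_product p i q" using theta_eq_theta_product assms by (simp add: t_def w_def)
  have e: "exp t = q ^ p" "exp w = q ^ i" "exp (t - w) = q ^ (p - i)"
    using exp_nome[of p] exp_nome[of i] exp_nome[of "p - i"] assms
    by (simp_all add: of_nat_diff algebra_simps t_def w_def)
  \<comment> \<open>Each residue class is summable by itself, so the series of differences from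
    \<open>logderiv_theta\<close> may be split and its two halves spread over the positions of i and
    p - i.\<close>
  have s: "summable (\<lambda>m. g (m * p + r))" if "0 < r" for r
  proof -
    have qp: "norm (q ^ p) < 1" using norm_nome_less_1 p by (simp add: norm_power power_less_one_iff)
    have "q ^ r * (q ^ p) ^ j \<noteq> 1" for j
      using nome_power_neq_1[of "r + p * j"] that by (simp add: power_add power_mult)
    then have "qpoch (q ^ r) (q ^ p) \<noteq> 0" by (simp add: qpoch_eq_0_iff[OF qp])
    from sums_summable[OF logderiv_qpoch[OF qp this]]
    have "summable (\<lambda>j. - (q ^ r) * - ((q ^ p) ^ j / (1 - q ^ r * (q ^ p) ^ j)))" by (rule summable_mult)
    then show ?thesis by (simp add: g_def power_add mult_ac flip: power_mult)
  qed
  have 1: "(\<lambda>n. of_bool (Suc n mod p = r) * g (Suc n)) sums (\<Sum>m. g (m * p + r))" if "0 < r" "r < p" for r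
    using sums_residue_class[OF that, of g] s[OF that(1)] by (simp add: summable_sums)
  have "(\<lambda>n. residue_sign p i (Suc n) * g (Suc n)) sums ((\<Sum>m. g (m * p + i)) - (\<Sum>m. g (m * p + (p - i))))"
    using sums_diff[OF 1[of i] 1[of "p - i"]] assms by (simp add: residue_sign_def algebra_simps)
  moreover have "(\<lambda>j. g (j * p + (p - i)) - g (j * p + i)) sums (deriv (theta t) w / theta t w)"
    using logderiv_theta[OF t, of w] theta_product_nonzero[OF assms] unfolding \<theta> e g_def
    by (simp add: power_add mult_ac flip: power_mult)
  then have *: "(\<Sum>m. g (m * p + (p - i))) - (\<Sum>m. g (m * p + i)) = deriv (theta t) w / theta t w"
    using sums_diff[OF summable_sums[OF s] summable_sums[OF s], of "p - i" i] assms by (simp add: sums_unique2)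
  have "(\<Sum>m. g (m * p + i)) - (\<Sum>m. g (m * p + (p - i))) = - (deriv (theta t) w / theta t w)"
    unfolding *[symmetric] by simp
  ultimately show ?thesis
    unfolding g_def t_def[symmetric] w_def[symmetric] \<theta>[symmetric] by simp
qed

theorem lambert_theta_quotient:
  assumes "0 < i" "0 < j" "0 < k" "i + j + k < p"
  shows "(\<lambda>n. (residue_sign p i (Suc n) + residue_sign p j (Suc n) + residue_sign p k (Suc n)
        - residue_sign p (i + j + k) (Suc n)) * (q ^ Suc n / (1 - q ^ Suc n))) sums
    (qpoch (q ^ p) (q ^ p) ^ 2 * theta_product p (i + j) q * theta_product p (i + k) q * theta_product p (j + k) q
      / (theta_product p i q * theta_product p j q * theta_product p k q * theta_product p (i + j + k) q) - 1)"
proof -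
  define u where "u = 2 * of_real pi * \<i> * \<tau>"
  define t where "t = of_nat p * u"
  define L where "L = (\<lambda>w. deriv (theta t) w / theta t w)"
  have t: "Re t < 0" using \<tau> p by (simp add: t_def u_def)
  have \<theta>: "theta t (of_nat r * u) = theta_product p r q" if "r < p" for r
    using theta_eq_theta_product[of r] that by (simp add: t_def u_def)
  have e: "exp t = q ^ p" using exp_nome[of p] by (simp add: t_def u_def)
  have l: "(\<lambda>n. residue_sign p r (Suc n) * (q ^ Suc n / (1 - q ^ Suc n))) sums - L (of_nat r * u)" if "0 < r" "r < p" for r
    using lambert_logderiv_theta[OF that] \<theta>[OF that(2)] unfolding L_def t_def u_def by simp
  have series: "(\<lambda>n. (residue_sign p i (Suc n) + residue_sign p j (Suc n) + residue_sign p k (Suc n)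
        - residue_sign p (i + j + k) (Suc n)) * (q ^ Suc n / (1 - q ^ Suc n))) sums
      (- L (of_nat i * u) + - L (of_nat j * u) + - L (of_nat k * u) - - L (of_nat (i + j + k) * u))"
    unfolding ring_distribs by (intro sums_add sums_diff l) (use assms in auto)
  have "1 - L (of_nat i * u) - L (of_nat j * u) - L (of_nat k * u) + L (of_nat (i + j + k) * u) =
    qpoch (q ^ p) (q ^ p) ^ 2 * theta_product p (i + j) q * theta_product p (i + k) q * theta_product p (j + k) q
      / (theta_product p i q * theta_product p j q * theta_product p k q * theta_product p (i + j + k) q)"
  proof -
    have add: "of_nat x * u + of_nat y * u = of_nat (x + y) * u" for x y
      by (simp add: distrib_right)
    have nz: "theta t (of_nat r * u) \<noteq> 0" if "0 < r" "r < p" for r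
      using theta_product_nonzero[OF that] \<theta>[OF that(2)] by simp
    have lt: "i < p" "j < p" "k < p" "i + j < p" "i + k < p" "j + k < p" "i + j + k < p" using assms by auto
    have "theta t (of_nat i * u) \<noteq> 0" "theta t (of_nat j * u) \<noteq> 0" "theta t (of_nat k * u) \<noteq> 0"
      "theta t (of_nat i * u + of_nat j * u) \<noteq> 0" "theta t (of_nat i * u + of_nat j * u + of_nat k * u) \<noteq> 0"
      unfolding add by (intro nz; use assms in simp)+
    from theta_four_term[OF t this] show ?thesis
      unfolding add L_def e \<theta>[OF lt(1)] \<theta>[OF lt(2)] \<theta>[OF lt(3)] \<theta>[OF lt(4)]
        \<theta>[OF lt(5)] \<theta>[OF lt(6)] \<theta>[OF lt(7)] .
  qed
  then have "- L (of_nat i * u) + - L (of_nat j * u) + - L (of_nat k * u) - - L (of_nat (i + j + k) * u) =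
    qpoch (q ^ p) (q ^ p) ^ 2 * theta_product p (i + j) q * theta_product p (i + k) q * theta_product p (j + k) q
      / (theta_product p i q * theta_product p j q * theta_product p k q * theta_product p (i + j + k) q) - 1"
    by (simp add: algebra_simps)
  with series show ?thesis by simp
qed

end

section \<open>Continuation of periodic Dirichlet series\<close>

text \<open>The sign is opposite to that of the usual forward difference, to match the terms that
  summation by parts produces. The argument is real so that differences can be bounded by
  derivatives.\<close>

primrec fdiff :: "nat \<Rightarrow> (real \<Rightarrow> complex) \<Rightarrow> real \<Rightarrow> complex" where
  "fdiff 0 \<phi> x = \<phi> x"
| "fdiff (Suc k) \<phi> x = fdiff k \<phi> x - fdiff k \<phi> (x + 1)"

lemma fdiff_diff_shift: "fdiff k (\<lambda>y. \<phi> y - \<phi> (y + 1)) x = fdiff (Suc k) \<phi> x"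
  by (induction k arbitrary: x) simp_all

text \<open>Each difference over a unit step is bounded by one derivative, where
  \<open>\<psi> j\<close> is the jth derivative of \<open>\<psi> 0\<close>. The induction
  differences the whole family at once, so a single use of the mean value inequality per step turns
  the bound on \<open>\<psi> (Suc k)\<close> into one on \<open>\<psi>' k\<close>.\<close>

lemma norm_fdiff_le:
  fixes \<psi> :: "nat \<Rightarrow> real \<Rightarrow> complex"
  assumes "x > 0"
    and "\<And>j y. y > 0 \<Longrightarrow> (\<psi> j has_vector_derivative \<psi> (Suc j) y) (at y)"
    and "\<And>y. y \<ge> x \<Longrightarrow> norm (\<psi> k y) \<le> M"
  shows "norm (fdiff k (\<psi> 0) x) \<le> M"
  using assms
proof (induction k arbitrary: \<psi>)
  case 0
  then show ?case by simp
next
  case (Suc k)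
  define \<psi>' where "\<psi>' j y = \<psi> j y - \<psi> j (y + 1)" for j y
  have "norm (fdiff k (\<psi>' 0) x) \<le> M"
  proof (rule Suc.IH)
    show "x > 0" by fact
    show "(\<psi>' j has_vector_derivative \<psi>' (Suc j) y) (at y)" if "y > 0" for j y
    proof -
      have "((\<lambda>y. \<psi> j (y + 1)) has_vector_derivative \<psi> (Suc j) (y + 1)) (at y)"
        using vector_diff_chain_at[of "\<lambda>y. y + 1" 1 y "\<psi> j" "\<psi> (Suc j) (y + 1)"]
          Suc.prems(2)[of "y + 1" j] that
        by (simp add: o_def has_vector_derivative_add_const[of _ 1, simplified add.commute[of 1]]
            has_vector_derivative_id[unfolded id_def])
      then show ?thesis unfolding \<psi>'_def
        by (intro has_vector_derivative_diff Suc.prems(2) that)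
    qed
    show "norm (\<psi>' k y) \<le> M" if "y \<ge> x" for y
    proof -
      have "norm (\<psi> k (y + 1) - \<psi> k y) \<le> norm ((y + 1) - y) * M"
      proof (rule differentiable_bound[where S = "{y..y+1}" and f' = "\<lambda>z h. h *\<^sub>R \<psi> (Suc k) z", THEN order.trans])
        fix z assume z: "z \<in> {y..y+1}"
        then have "z > 0" using that \<open>x > 0\<close> by auto
        show "(\<psi> k has_derivative (\<lambda>h. h *\<^sub>R \<psi> (Suc k) z)) (at z within {y..y+1})"
          using Suc.prems(2)[OF \<open>z > 0\<close>, of k] has_vector_derivative_at_within
          unfolding has_vector_derivative_def by (metis has_derivative_at_withinI)
        show "onorm (\<lambda>h. h *\<^sub>R \<psi> (Suc k) z) \<le> M"
          using Suc.prems(3)[of z] z that by (intro onorm_le) (simp add: mult.commute[of M] mult_left_mono)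
      qed auto
      then show ?thesis by (simp add: \<psi>'_def norm_minus_commute)
    qed
  qed
  moreover have "\<psi>' 0 = (\<lambda>y. \<psi> 0 y - \<psi> 0 (y + 1))" by (simp add: \<psi>'_def fun_eq_iff)
  ultimately show ?case by (simp only: fdiff_diff_shift)
qed

definition npow :: "complex \<Rightarrow> real \<Rightarrow> complex" where
  "npow s x = of_real x powr (- s)"

text \<open>The kth derivative of the power with exponent -s carries the factor
  \<open>pochhammer s k\<close> up to sign and has exponent -s - k. Its norm is nonincreasing when
  Re s + k >= 0, so the supremum on the half-line from x is attained at x.\<close>

lemma norm_fdiff_npow_le:
  assumes "x > 0" "Re s + real k \<ge> 0"
  shows "norm (fdiff k (npow s) x) \<le> norm (pochhammer s k) * x powr (- (Re s + real k))"
proof -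
  define \<psi> where "\<psi> j y = (- 1) ^ j * pochhammer s j * of_real y powr (- s - of_nat j)" for j :: nat and y :: real
  have "norm (fdiff k (\<psi> 0) x) \<le> norm (pochhammer s k) * x powr (- (Re s + real k))"
  proof (rule norm_fdiff_le[OF assms(1)])
    fix j and y :: real assume y: "y > 0"
    have "((\<lambda>z. (- 1) ^ j * pochhammer s j * z powr (- s - of_nat j)) has_field_derivative
        (- 1) ^ j * pochhammer s j * ((- s - of_nat j) * of_real y powr (- s - of_nat j - 1))) (at (of_real y))"
      using y by (intro DERIV_cmult has_field_derivative_powr) (auto simp: complex_nonpos_Reals_iff)
    then have "(\<psi> j has_vector_derivative
        (- 1) ^ j * pochhammer s j * ((- s - of_nat j) * of_real y powr (- s - of_nat j - 1))) (at y)"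
      unfolding \<psi>_def by (rule has_vector_derivative_real_field)
    moreover have "(- 1) ^ j * pochhammer s j * ((- s - of_nat j) * of_real y powr (- s - of_nat j - 1)) = \<psi> (Suc j) y"
      by (simp add: \<psi>_def pochhammer_Suc algebra_simps)
    ultimately show "(\<psi> j has_vector_derivative \<psi> (Suc j) y) (at y)" by simp
  next
    fix y assume y: "y \<ge> x"
    then have "norm (\<psi> k y) = norm (pochhammer s k) * y powr (- (Re s + real k))"
      using assms(1) by (simp add: \<psi>_def norm_mult norm_power norm_powr_real_powr)
    also have "\<dots> \<le> norm (pochhammer s k) * x powr (- (Re s + real k))"
      using assms y by (intro mult_left_mono powr_mono2') auto
    finally show "norm (\<psi> k y) \<le> norm (pochhammer s k) * x powr (- (Re s + real k))" .
  qed
  moreover have "\<psi> 0 = npow s" by (auto simp: \<psi>_def npow_def)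
  ultimately show ?thesis by simp
qed

lemma holomorphic_fdiff_npow: "x > 0 \<Longrightarrow> (\<lambda>s. fdiff k (npow s) x) holomorphic_on A"
proof (induction k arbitrary: x)
  case 0
  then show ?case unfolding fdiff.simps npow_def by (intro holomorphic_intros) auto
next
  case (Suc k)
  then show ?case by (auto intro!: holomorphic_intros)
qed

lemma fdiff_const: "(\<And>y. y \<ge> x \<Longrightarrow> \<phi> y = c) \<Longrightarrow> fdiff k \<phi> x = (if k = 0 then c else 0)"
  by (induction k arbitrary: x) auto

text \<open>\<open>psum_mean\<close> is the Abel (or Cesaro) value of the divergent series $\sum_n f(n)$; it
  turns out to be the value of the continued Dirichlet series at 0.\<close>

definition psum_mean :: "nat \<Rightarrow> (nat \<Rightarrow> complex) \<Rightarrow> complex" where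
  "psum_mean p f = (\<Sum>n<p. \<Sum>m\<le>n. f m) / of_nat p"

text \<open>A discrete antiderivative, normalised to have mean 0 over a period; without that, the
  next summation by parts would meet unbounded partial sums.\<close>

definition psum_centered :: "nat \<Rightarrow> (nat \<Rightarrow> complex) \<Rightarrow> nat \<Rightarrow> complex" where
  "psum_centered p f n = (\<Sum>m\<le>n. f m) - psum_mean p f"

definition mean_free_periodic :: "nat \<Rightarrow> (nat \<Rightarrow> complex) \<Rightarrow> bool" where
  "mean_free_periodic p f \<longleftrightarrow> p > 0 \<and> (\<forall>n. f (n + p) = f n) \<and> (\<Sum>n<p. f n) = 0"

lemma mean_free_periodic_psum_centered:
  assumes "mean_free_periodic p f"
  shows "mean_free_periodic p (psum_centered p f)"
proof -
  have p: "p > 0" and per: "\<And>n. f (n + p) = f n" and s0: "(\<Sum>n<p. f n) = 0"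
    using assms by (auto simp: mean_free_periodic_def)
  have "(\<Sum>m\<le>n + p. f m) = (\<Sum>m\<le>n. f m)" for n
  proof (induction n)
    case 0
    have "{..p} = insert p {..<p}" by auto
    then show ?case using s0 per[of 0] by simp
  next
    case (Suc n)
    then show ?case using per[of "Suc n"] by simp
  qed
  moreover have "(\<Sum>n<p. psum_centered p f n) = 0"
    using p by (simp add: psum_centered_def sum_subtractf psum_mean_def)
  ultimately show ?thesis using p by (simp add: mean_free_periodic_def psum_centered_def)
qed

lemma mean_free_periodic_bounded:
  assumes "mean_free_periodic p f"
  obtains B where "B \<ge> 0" "\<And>n. norm (f n) \<le> B"
proof -
  have p: "p > 0" and per: "\<And>n. f (n + p) = f n"
    using assms by (auto simp: mean_free_periodic_def)
  have "f n = f (n mod p)" for n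
  proof (induction n rule: less_induct)
    case (less n)
    show ?case
    proof (cases "n < p")
      case False
      then show ?thesis using less[of "n - p"] per[of "n - p"] p by (simp add: le_mod_geq)
    qed simp
  qed
  then have "norm (f n) \<le> (\<Sum>m<p. norm (f m))" for n
    using p member_le_sum[of "n mod p" "{..<p}" "\<lambda>m. norm (f m)"] by simp
  then show thesis using that[of "\<Sum>m<p. norm (f m)"] by (simp add: sum_nonneg)
qed

text \<open>The last coefficient is \<open>psum_centered\<close> at N - 1, written with m < N so
  that the formula also holds for N = 0.\<close>

lemma summation_by_parts:
  fixes f \<phi> :: "nat \<Rightarrow> complex"
  shows "(\<Sum>n<N. f n * \<phi> n) =
    psum_mean p f * \<phi> 0 + (\<Sum>n<N. psum_centered p f n * (\<phi> n - \<phi> (Suc n)))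
      + ((\<Sum>m<N. f m) - psum_mean p f) * \<phi> N"
proof (induction N)
  case (Suc N)
  have "(\<Sum>m\<le>N. f m) = (\<Sum>m<N. f m) + f N" by (simp flip: lessThan_Suc_atMost)
  with Suc show ?case by (simp add: psum_centered_def algebra_simps)
qed simp

text \<open>The centred partial sums are bounded by periodicity and \<open>\<phi>\<close> tends to
  0, so the boundary term disappears in the limit.\<close>

lemma suminf_by_parts:
  fixes f \<phi> :: "nat \<Rightarrow> complex"
  assumes f: "mean_free_periodic p f" and \<phi>: "\<phi> \<longlonglongrightarrow> 0"
    and s: "summable (\<lambda>n. psum_centered p f n * (\<phi> n - \<phi> (Suc n)))"
  shows "(\<Sum>n. f n * \<phi> n) = psum_mean p f * \<phi> 0 + (\<Sum>n. psum_centered p f n * (\<phi> n - \<phi> (Suc n)))"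
proof -
  obtain B where B: "\<And>n. norm (psum_centered p f n) \<le> B"
    using mean_free_periodic_bounded[OF mean_free_periodic_psum_centered[OF f]] by metis
  have bound: "norm ((\<Sum>m<N. f m) - psum_mean p f) \<le> B + norm (psum_mean p f)" for N
  proof (cases N)
    case (Suc n)
    then show ?thesis using B[of n] norm_ge_zero[of "psum_mean p f"]
      unfolding psum_centered_def Suc lessThan_Suc_atMost by linarith
  qed (use order.trans[OF norm_ge_zero B[of 0]] in simp)
  have lim: "(\<lambda>N. (B + norm (psum_mean p f)) * norm (\<phi> N)) \<longlonglongrightarrow> 0"
    using tendsto_mult_right_zero[OF tendsto_norm_zero[OF \<phi>]] .
  have "(\<lambda>N. ((\<Sum>m<N. f m) - psum_mean p f) * \<phi> N) \<longlonglongrightarrow> 0"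
    using lim by (rule Lim_null_comparison[rotated]) (simp add: norm_mult bound mult_right_mono)
  then have "(\<lambda>N. psum_mean p f * \<phi> 0 + (\<Sum>n<N. psum_centered p f n * (\<phi> n - \<phi> (Suc n)))
      + ((\<Sum>m<N. f m) - psum_mean p f) * \<phi> N) \<longlonglongrightarrow>
    psum_mean p f * \<phi> 0 + (\<Sum>n. psum_centered p f n * (\<phi> n - \<phi> (Suc n))) + 0"
    by (intro tendsto_intros summable_LIMSEQ s)
  then have "(\<lambda>n. f n * \<phi> n) sums
      (psum_mean p f * \<phi> 0 + (\<Sum>n. psum_centered p f n * (\<phi> n - \<phi> (Suc n))))"
    unfolding sums_def summation_by_parts[of f \<phi> _ p] by simp
  then show ?thesis by (rule sums_unique[symmetric])
qed

context
  fixes p :: nat and f :: "nat \<Rightarrow> complex"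
  assumes f: "mean_free_periodic p f"
begin

lemma mean_free_periodic_iterate: "mean_free_periodic p ((psum_centered p ^^ k) f)"
  by (induction k) (simp_all add: f mean_free_periodic_psum_centered)

text \<open>Each summation by parts replaces the powers $n^{-s}$ by a further finite difference, which
  improves their decay to $O(n^{-\mathrm{Re}\, s - k})$ after $k$ steps.\<close>

definition abel_tail :: "nat \<Rightarrow> complex \<Rightarrow> nat \<Rightarrow> complex" where
  "abel_tail k s n = (psum_centered p ^^ k) f n * fdiff k (npow s) (real (Suc n))"

text \<open>The boundary terms of k summations by parts together with the remaining series, which
  converges for Re s > 1 - k.\<close>

definition abel_continuation :: "nat \<Rightarrow> complex \<Rightarrow> complex" where
  "abel_continuation k s =
    (\<Sum>j<k. psum_mean p ((psum_centered p ^^ j) f) * fdiff j (npow s) 1) + (\<Sum>n. abel_tail k s n)"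

lemma norm_abel_tail_le:
  obtains B where "B \<ge> 0" "\<And>s n. Re s + real k \<ge> 0 \<Longrightarrow>
    norm (abel_tail k s n) \<le> B * (norm (pochhammer s k) * real (Suc n) powr (- (Re s + real k)))"
proof -
  obtain B where B: "B \<ge> 0" "\<And>n. norm ((psum_centered p ^^ k) f n) \<le> B"
    using mean_free_periodic_bounded[OF mean_free_periodic_iterate] by metis
  show thesis
  proof (rule that[OF B(1)])
    fix s n assume "Re s + real k \<ge> 0"
    then show "norm (abel_tail k s n) \<le> B * (norm (pochhammer s k) * real (Suc n) powr (- (Re s + real k)))"
      unfolding abel_tail_def norm_mult using B by (intro mult_mono norm_fdiff_npow_le) auto
  qed
qed

lemma summable_Suc_powr:
  assumes "a > 1"
  shows "summable (\<lambda>n. real (Suc n) powr (- a))"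
  using assms summable_Suc_iff[of "\<lambda>n. real n powr (- a)"] by (simp add: summable_real_powr_iff)

lemma summable_abel_tail:
  assumes "Re s + real k > 1"
  shows "summable (abel_tail k s)"
proof -
  have "Re s + real k \<ge> 0" using assms by simp
  with norm_abel_tail_le[of k] obtain B where B: "\<And>n. norm (abel_tail k s n) \<le> B * (norm (pochhammer s k) * real (Suc n) powr (- (Re s + real k)))"
    by metis
  show ?thesis
    using B by (rule summable_comparison_test'[where N = 0, rotated])
       (intro summable_mult summable_Suc_powr assms)
qed

lemma abel_continuation_Suc:
  assumes "Re s + real k > 1"
  shows "abel_continuation (Suc k) s = abel_continuation k s"
proof -
  define \<phi> where "\<phi> n = fdiff k (npow s) (real (Suc n))" for n
  have "(\<lambda>n. norm (pochhammer s k) * real (Suc n) powr (- (Re s + real k))) \<longlonglongrightarrow> 0"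
    by (intro summable_LIMSEQ_zero summable_mult summable_Suc_powr assms)
  then have "\<phi> \<longlonglongrightarrow> 0"
    by (rule Lim_null_comparison[rotated])
       (use norm_fdiff_npow_le[of _ s k] assms in \<open>simp add: \<phi>_def\<close>)
  moreover have tail: "abel_tail (Suc k) s = (\<lambda>n. psum_centered p ((psum_centered p ^^ k) f) n * (\<phi> n - \<phi> (Suc n)))"
    by (auto simp: abel_tail_def \<phi>_def add_ac)
  moreover have "summable (abel_tail (Suc k) s)" using assms by (intro summable_abel_tail) simp
  ultimately have "(\<Sum>n. (psum_centered p ^^ k) f n * \<phi> n) =
     psum_mean p ((psum_centered p ^^ k) f) * \<phi> 0 + (\<Sum>n. abel_tail (Suc k) s n)"
    using suminf_by_parts[OF mean_free_periodic_iterate] by simp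
  moreover have "abel_tail k s = (\<lambda>n. (psum_centered p ^^ k) f n * \<phi> n)"
    by (auto simp: abel_tail_def \<phi>_def)
  ultimately show ?thesis by (simp add: abel_continuation_def \<phi>_def)
qed

lemma abel_continuation_eq:
  assumes "Re s + real k > 1" "Re s + real l > 1"
  shows "abel_continuation k s = abel_continuation l s"
proof -
  have "abel_continuation (k + d) s = abel_continuation k s" if "Re s + real k > 1" for k d
    by (induction d) (use that abel_continuation_Suc in auto)
  then show ?thesis using assms by (metis le_add_diff_inverse nle_le)
qed

lemma holomorphic_abel_continuation:
  "abel_continuation k holomorphic_on {s. Re s + real k > 1}"
proof -
  have open_half: "open {s. Re s + real k > 1}"
    by (intro open_Collect_less continuous_intros)
  have "(\<lambda>s. \<Sum>n. abel_tail k s n) holomorphic_on {s. Re s + real k > 1}"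
  proof (rule holomorphic_uniform_sequence[OF open_half])
    show "(\<lambda>s. \<Sum>n<N. abel_tail k s n) holomorphic_on {s. Re s + real k > 1}" for N
      unfolding abel_tail_def by (intro holomorphic_intros holomorphic_fdiff_npow) auto
  next
    fix s0 assume "s0 \<in> {s. Re s + real k > 1}"
    then obtain d where d: "d > 0" "cball s0 d \<subseteq> {s. Re s + real k > 1}"
      using open_half open_contains_cball by blast
    obtain B where B: "B \<ge> 0" "\<And>s n. Re s + real k \<ge> 0 \<Longrightarrow>
        norm (abel_tail k s n) \<le> B * (norm (pochhammer s k) * real (Suc n) powr (- (Re s + real k)))"
      using norm_abel_tail_le by metis
    have "compact ((\<lambda>s. pochhammer s k) ` cball s0 d)"
      unfolding pochhammer_prod by (intro compact_continuous_image continuous_intros compact_cball)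
    then have "bounded ((\<lambda>s. pochhammer s k) ` cball s0 d)" by (rule compact_imp_bounded)
    then obtain C where C: "\<And>s. s \<in> cball s0 d \<Longrightarrow> norm (pochhammer s k) \<le> C"
      unfolding bounded_iff by (metis imageI)
    have C0: "C \<ge> 0" by (rule order.trans[OF norm_ge_zero C[of s0]]) (use d in simp)
    \<comment> \<open>The leftmost point of the disc still lies in the half-plane, so one exponent
      above 1 dominates on the whole disc.\<close>
    have s0: "Re s0 - d + real k > 1" using d by (auto dest!: subsetD[where c = "s0 - of_real d"] simp: dist_norm)
    have "uniform_limit (cball s0 d) (\<lambda>N s. \<Sum>n<N. abel_tail k s n) (\<lambda>s. \<Sum>n. abel_tail k s n) sequentially"
    proof (rule Weierstrass_m_test)
      show "summable (\<lambda>n. B * (C * real (Suc n) powr (- (Re s0 - d + real k))))"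
        by (intro summable_mult summable_Suc_powr s0)
      fix n s assume s: "s \<in> cball s0 d"
      then have "Re s0 - Re s \<le> d"
        using complex_Re_le_cmod[of "s0 - s"] by (simp add: dist_norm)
      then have "real (Suc n) powr (- (Re s + real k)) \<le> real (Suc n) powr (- (Re s0 - d + real k))"
        by (intro powr_mono) auto
      then have "B * (norm (pochhammer s k) * real (Suc n) powr (- (Re s + real k)))
          \<le> B * (C * real (Suc n) powr (- (Re s0 - d + real k)))"
        using B(1) C[OF s] C0 by (intro mult_left_mono mult_mono) auto
      moreover have "Re s + real k \<ge> 0" using d(2) s by force
      ultimately show "norm (abel_tail k s n) \<le> B * (C * real (Suc n) powr (- (Re s0 - d + real k)))"
        using B(2) order.trans by blast
    qed
    then show "\<exists>d>0. cball s0 d \<subseteq> {s. Re s + real k > 1} \<and>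
        uniform_limit (cball s0 d) (\<lambda>N s. \<Sum>n<N. abel_tail k s n) (\<lambda>s. \<Sum>n. abel_tail k s n) sequentially"
      using d by blast
  qed
  then show ?thesis
    unfolding abel_continuation_def by (intro holomorphic_intros holomorphic_fdiff_npow) auto
qed

theorem entire_continuation_periodic_dirichlet_series:
  obtains L where "L holomorphic_on UNIV"
    "\<And>s. Re s > 1 \<Longrightarrow> L s = (\<Sum>n. f n * of_nat (Suc n) powr (- s))"
    "L 0 = psum_mean p f"
proof -
  \<comment> \<open>Any k with Re s + k > 1 gives the same value by
    \<open>abel_continuation_eq\<close>; the ceiling merely selects one. On each half-plane
    \<open>L\<close> thus agrees with a single holomorphic function.\<close>
  define L where "L s = abel_continuation (nat \<lceil>2 - Re s\<rceil>) s" for s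
  have L: "L s = abel_continuation k s" if "Re s + real k > 1" for s k
    unfolding L_def by (intro abel_continuation_eq that) linarith
  have "L holomorphic_on UNIV"
  proof -
    have "L holomorphic_on (\<Union>k. {s. Re s + real k > 1})"
    proof (rule holomorphic_on_UN_open)
      show "L holomorphic_on {s. Re s + real k > 1}" for k
        using holomorphic_abel_continuation[of k] by (rule holomorphic_transform) (simp add: L)
      show "open {s. Re s + real k > 1}" for k
        by (intro open_Collect_less continuous_intros)
    qed
    moreover have "(\<Union>k. {s. Re s + real k > 1}) = UNIV"
    proof (intro equalityI subsetI)
      fix s :: complex
      obtain k where "1 - Re s < real k" using reals_Archimedean2 by blast
      then show "s \<in> (\<Union>k. {s. Re s + real k > 1})" by (auto intro!: exI[of _ k])
    qed auto
    ultimately show ?thesis by simp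
  qed
  moreover have "L s = (\<Sum>n. f n * of_nat (Suc n) powr (- s))" if "Re s > 1" for s
    using L[of s 0] that by (simp add: abel_continuation_def abel_tail_def npow_def)
  moreover have "L 0 = psum_mean p f"
  proof -
    \<comment> \<open>At s = 0 the powers are constantly 1, so every difference of positive order
      vanishes and only the first boundary term remains. Below, k = 2 is the least number of rounds
      with Re 0 + k > 1.\<close>
    have "fdiff k (npow 0) x = (if k = 0 then 1 else 0)" if "x > 0" for k x
      using that by (intro fdiff_const) (simp add: npow_def)
    note * = this
    have "abel_tail 2 0 n = 0" for n unfolding abel_tail_def by (subst *) auto
    moreover have "(\<Sum>j<2. psum_mean p ((psum_centered p ^^ j) f) * fdiff j (npow 0) 1) = psum_mean p f"
      by (simp add: * numeral_2_eq_2 del: fdiff.simps)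
    ultimately show ?thesis
      using L[of 0 2] by (simp add: abel_continuation_def)
  qed
  ultimately show thesis by (rule that)
qed

end

section \<open>Odd characters and the value at 0\<close>

lemma dirichlet_character_cong:
  assumes "dirichlet_character n \<psi>" "[a = b] (mod int n)"
  shows "\<psi> a = \<psi> b"
proof -
  have per: "\<psi> (c + int n) = \<psi> c" for c using assms(1) by (simp add: dirichlet_character_def)
  have "\<psi> (b + k * int n) = \<psi> b" for k
  proof (induction k rule: int_induct[where k = 0])
    case (step1 k)
    then show ?case using per[of "b + k * int n"] by (simp add: algebra_simps)
  next
    case (step2 k)
    then show ?case using per[of "b + (k - 1) * int n"] by (simp add: algebra_simps)
  qed simp
  moreover obtain k where "a = b + int n * k" using assms(2) cong_iff_lin[of b a] cong_sym by metis
  ultimately show ?thesis by (metis mult.commute)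
qed

lemma dirichlet_character_power:
  assumes "dirichlet_character n \<psi>"
  shows "\<psi> (a ^ k) = \<psi> a ^ k"
  using assms by (induction k) (simp_all add: dirichlet_character_def)

lemma odd_character_minus:
  assumes "dirichlet_character n \<psi>" "odd_character \<psi>"
  shows "\<psi> (- a) = - \<psi> a"
  using assms unfolding dirichlet_character_def odd_character_def
  by (metis mult_minus1)

lemma dirichlet_character_self_eq_0:
  assumes "dirichlet_character n \<psi>" "n > 1"
  shows "\<psi> (int n) = 0"
  using assms by (simp add: dirichlet_character_def)

lemma odd_character_reflect:
  assumes "dirichlet_character n \<psi>" "odd_character \<psi>" "m \<le> n"
  shows "\<psi> (int (n - m)) = - \<psi> (int m)"
proof -
  have "[int (n - m) = - int m] (mod int n)"
    using assms(3) by (simp add: of_nat_diff cong_iff_dvd_diff)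
  then show ?thesis using dirichlet_character_cong[OF assms(1)] odd_character_minus[OF assms(1,2)] by simp
qed

lemma sum_odd_character:
  assumes "dirichlet_character n \<psi>" "odd_character \<psi>"
  shows "(\<Sum>m\<in>{1..<n}. \<psi> (int m)) = 0"
proof -
  have "(\<Sum>m\<in>{1..<n}. \<psi> (int m)) = (\<Sum>m\<in>{1..<n}. \<psi> (int (n - m)))"
    by (rule sum.reindex_bij_witness[of _ "\<lambda>m. n - m" "\<lambda>m. n - m"]) auto
  also have "\<dots> = - (\<Sum>m\<in>{1..<n}. \<psi> (int m))"
    unfolding sum_negf[symmetric] by (intro sum.cong refl odd_character_reflect assms) auto
  finally show ?thesis by simp
qed

lemma sum_partial_sums:
  fixes f :: "nat \<Rightarrow> complex"
  shows "(\<Sum>n<N. \<Sum>m\<le>n. f m) = of_nat N * (\<Sum>m<N. f m) - (\<Sum>m<N. of_nat m * f m)"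
proof (induction N)
  case (Suc N)
  have "(\<Sum>m\<le>N. f m) = (\<Sum>m<N. f m) + f N" by (simp flip: lessThan_Suc_atMost)
  with Suc show ?case by (simp add: algebra_simps)
qed simp

lemma dirichlet_L_eqI:
  assumes "L holomorphic_on UNIV" "\<And>s. Re s > 1 \<Longrightarrow> L s = dirichlet_L_series \<psi> s"
  shows "dirichlet_L \<psi> = L"
  unfolding dirichlet_L_def
proof (rule the_equality)
  fix g assume g: "g holomorphic_on UNIV \<and> (\<forall>s. Re s > 1 \<longrightarrow> g s = dirichlet_L_series \<psi> s)"
  show "g = L"
  proof
    fix z
    show "g z = L z"
    proof (rule analytic_continuation_open[of "{s. Re s > 1}" UNIV g L])
      show "open {s. Re s > 1}" by (intro open_Collect_less continuous_intros)
      show "{s. Re s > 1} \<noteq> {}" by (auto intro!: exI[of _ 2])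
    qed (use assms g in auto)
  qed
qed (use assms in auto)

lemma mean_free_periodic_odd_character:
  assumes \<psi>: "dirichlet_character n \<psi>" and odd: "odd_character \<psi>" and n: "n > 1"
  shows "mean_free_periodic n (\<lambda>m. \<psi> (int (Suc m)))"
proof -
  have "(\<Sum>m<n. \<psi> (int (Suc m))) = (\<Sum>m\<in>{1..n}. \<psi> (int m))"
    by (rule sum.reindex_bij_witness[of _ "\<lambda>m. m - 1" Suc]) auto
  also have "{1..n} = insert n {1..<n}" using n by auto
  finally have "(\<Sum>m<n. \<psi> (int (Suc m))) = 0"
    using dirichlet_character_self_eq_0[OF \<psi> n] sum_odd_character[OF \<psi> odd] by simp
  moreover have "\<psi> (int (Suc (m + n))) = \<psi> (int (Suc m))" for m
    by (rule dirichlet_character_cong[OF \<psi>]) (simp add: cong_iff_dvd_diff)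
  ultimately show ?thesis using n by (simp add: mean_free_periodic_def)
qed

text \<open>The mean of the partial sums counts f(m) once for each n >= m in a period; as the
  coefficients sum to 0, this leaves the sum weighted by -m.\<close>

lemma dirichlet_L_odd_0:
  assumes \<psi>: "dirichlet_character n \<psi>" and "odd_character \<psi>" "n > 1"
  shows "dirichlet_L \<psi> 0 = - (\<Sum>m\<in>{1..<n}. of_nat m * \<psi> (int m)) / of_nat n"
proof -
  define f where "f m = \<psi> (int (Suc m))" for m
  have mfp: "mean_free_periodic n f"
    unfolding f_def by (rule mean_free_periodic_odd_character[OF assms])
  then have f0: "(\<Sum>m<n. f m) = 0" by (simp add: mean_free_periodic_def)
  obtain L where L: "L holomorphic_on UNIV"
      "\<And>s. Re s > 1 \<Longrightarrow> L s = (\<Sum>m. f m * of_nat (Suc m) powr (- s))" "L 0 = psum_mean n f"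
    using entire_continuation_periodic_dirichlet_series[OF mfp] by blast
  have "dirichlet_L \<psi> = L"
    by (rule dirichlet_L_eqI[OF L(1)]) (simp add: L(2) dirichlet_L_series_def f_def)
  moreover have "(\<Sum>m<n. of_nat m * f m) = (\<Sum>m\<in>{1..<n}. of_nat m * \<psi> (int m))"
  proof -
    \<comment> \<open>The coefficients are shifted by one, \<open>f m\<close> belonging to m + 1.
      Replacing the weight m by m + 1 is harmless because they sum to 0.\<close>
    have "(\<Sum>m<n. of_nat m * f m) = (\<Sum>m<n. of_nat (Suc m) * f m)"
      using f0 by (simp add: distrib_right sum.distrib)
    also have "\<dots> = (\<Sum>m\<in>{1..n}. of_nat m * \<psi> (int m))"
      unfolding f_def by (rule sum.reindex_bij_witness[of _ "\<lambda>m. m - 1" Suc]) auto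
    also have "{1..n} = insert n {1..<n}" using assms(3) by auto
    finally show ?thesis using dirichlet_character_self_eq_0[OF \<psi> assms(3)] by simp
  qed
  ultimately show ?thesis
    by (simp add: L(3) psum_mean_def sum_partial_sums f0)
qed

lemma prime_coprime_int_iff:
  assumes "prime p"
  shows "coprime a (int p) \<longleftrightarrow> \<not> int p dvd a"
  using assms by (metis coprime_commute coprime_absorb_left not_prime_unit prime_imp_coprime prime_int_nat_transfer prime_nat_int_transfer of_nat_eq_iff coprime_absorb_right)

text \<open>Multiplication by i permutes the nonzero residues, and the character turns this
  permutation into the factor \<open>\<psi> (int i)\<close>.\<close>

lemma sum_character_mult_mod:
  assumes p: "prime p" and \<psi>: "dirichlet_character p \<psi>" and i: "0 < i" "i < p"
  shows "(\<Sum>m\<in>{1..<p}. \<psi> (int m) * of_nat (i * m mod p)) = (\<Sum>m\<in>{1..<p}. of_nat m * \<psi> (int m)) / \<psi> (int i)"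
proof -
  have ndvd: "\<not> p dvd i" using i nat_dvd_not_less by blast
  have nz: "\<psi> (int i) \<noteq> 0"
    using \<psi> prime_coprime_int_iff[OF p, of "int i"] ndvd by (simp add: dirichlet_character_def)
  have cop: "coprime i p" using ndvd p by (metis coprime_commute prime_imp_coprime)
  have inj: "inj_on (\<lambda>m. i * m mod p) {1..<p}"
  proof (rule inj_onI)
    fix x y assume xy: "x \<in> {1..<p}" "y \<in> {1..<p}" "i * x mod p = i * y mod p"
    then have "[x = y] (mod p)" using cong_mult_lcancel_nat[OF cop] by (simp add: cong_def)
    then show "x = y" using xy by (simp add: cong_def)
  qed
  have "(\<lambda>m. i * m mod p) ` {1..<p} \<subseteq> {1..<p}"
  proof safe
    fix m assume m: "m \<in> {1..<p}"
    then have "\<not> p dvd i * m" using ndvd p by (auto simp: prime_dvd_mult_iff dest: dvd_imp_le)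
    then have "i * m mod p \<noteq> 0" by (simp add: dvd_eq_mod_eq_0)
    then show "i * m mod p \<in> {1..<p}" using m by simp
  qed
  then have "(\<lambda>m. i * m mod p) ` {1..<p} = {1..<p}"
    using inj by (intro endo_inj_surj) auto
  then have bij: "bij_betw (\<lambda>m. i * m mod p) {1..<p} {1..<p}"
    using inj by (simp add: bij_betw_def)
  have "(\<Sum>m\<in>{1..<p}. of_nat m * \<psi> (int m)) = (\<Sum>m\<in>{1..<p}. of_nat (i * m mod p) * \<psi> (int (i * m mod p)))"
    by (rule sum.reindex_bij_betw[OF bij, symmetric])
  also have "\<dots> = (\<Sum>m\<in>{1..<p}. \<psi> (int i) * (\<psi> (int m) * of_nat (i * m mod p)))"
  proof (rule sum.cong)
    fix m
    have "\<psi> (int (i * m mod p)) = \<psi> (int i * int m)"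
      by (rule dirichlet_character_cong[OF \<psi>]) (simp add: cong_def zmod_int)
    also have "\<dots> = \<psi> (int i) * \<psi> (int m)" using \<psi> by (simp add: dirichlet_character_def)
    finally show "of_nat (i * m mod p) * \<psi> (int (i * m mod p)) = \<psi> (int i) * (\<psi> (int m) * of_nat (i * m mod p))"
      by simp
  qed simp
  finally show ?thesis using nz by (simp add: sum_distrib_left[symmetric])
qed

lemma dirichlet_L_odd_0_inverse:
  assumes p: "prime p" "p > 2" and \<psi>: "dirichlet_character p \<psi>" "odd_character \<psi>"
    and ijk: "0 < i" "0 < j" "0 < k" "i + j + k < p"
    and bal: "\<And>m. m \<in> {1..<p} \<Longrightarrow> i * m mod p + j * m mod p + k * m mod p =
      (i + j + k) * m mod p + (if m = 1 then 0 else if m = p - 1 then 2 * p else p)"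
  shows "2 / dirichlet_L \<psi> 0 = 1 / \<psi> (int i) + 1 / \<psi> (int j) + 1 / \<psi> (int k) - 1 / \<psi> (int (i + j + k))"
    (is "_ = ?C")
proof -
  txt \<open>Sum \<open>bal\<close> against \<open>\<psi>\<close>; only the exceptional values at $m = \pm 1$ survive.\<close>
  define T where "T = (\<Sum>m\<in>{1..<p}. of_nat m * \<psi> (int m))"
  have S: "(\<Sum>m\<in>{1..<p}. \<psi> (int m) * of_nat (r * m mod p)) = T / \<psi> (int r)" if "0 < r" "r < p" for r
    unfolding T_def using sum_character_mult_mod[OF p(1) \<psi>(1) that] .
  have "T * ?C = (\<Sum>m\<in>{1..<p}. \<psi> (int m) * of_nat (i * m mod p)) + (\<Sum>m\<in>{1..<p}. \<psi> (int m) * of_nat (j * m mod p))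
      + (\<Sum>m\<in>{1..<p}. \<psi> (int m) * of_nat (k * m mod p)) - (\<Sum>m\<in>{1..<p}. \<psi> (int m) * of_nat ((i + j + k) * m mod p))"
    using ijk by (subst (1 2 3 4) S) (auto simp: algebra_simps)
  also have "\<dots> = (\<Sum>m\<in>{1..<p}. \<psi> (int m) * (of_nat (i * m mod p + j * m mod p + k * m mod p) - of_nat ((i + j + k) * m mod p)))"
    by (simp add: sum.distrib sum_subtractf algebra_simps)
  also have "\<dots> = (\<Sum>m\<in>{1..<p}. of_nat p * \<psi> (int m) - (if m = 1 then of_nat p * \<psi> (int m) else 0) + (if m = p - 1 then of_nat p * \<psi> (int m) else 0))"
    by (rule sum.cong[OF refl], subst bal) (use p(2) in auto)
  also have "\<dots> = of_nat p * (\<Sum>m\<in>{1..<p}. \<psi> (int m)) - of_nat p * \<psi> 1 + of_nat p * \<psi> (int (p - 1))"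
    using p(2) by (simp add: sum.distrib sum_subtractf sum_distrib_left)
  also have "\<dots> = - 2 * of_nat p"
    using sum_odd_character[OF \<psi>] odd_character_reflect[OF \<psi>, of 1] p(2) \<psi>(1)
    by (simp add: dirichlet_character_def)
  finally have TC: "T * ?C = - 2 * of_nat p" .
  have L0: "dirichlet_L \<psi> 0 = - T / of_nat p"
    using dirichlet_L_odd_0[OF \<psi>] p(2) by (simp add: T_def)
  \<comment> \<open>The right side of \<open>TC\<close> is nonzero, so the nonvanishing of L at 0
    comes for free from the triple.\<close>
  have T0: "T \<noteq> 0" using TC p(2) by auto
  have "?C = - 2 * of_nat p / T"
    using TC T0 by (metis nonzero_mult_div_cancel_left)
  then show ?thesis unfolding L0 using p(2) T0 by simp
qed

section \<open>Odd characters modulo a prime and their orthogonality\<close>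

definition odd_characters :: "nat \<Rightarrow> (int \<Rightarrow> complex) set" where
  "odd_characters n = {\<psi>. dirichlet_character n \<psi> \<and> odd_character \<psi>}"

text \<open>If N divides d, all terms equal (-1)^(d/N), whose sign separates the two residues.
  Otherwise multiplication by \<open>\<zeta>\<close>, a primitive Nth root of unity, permutes the
  roots of -1 and scales the sum by \<open>\<zeta> ^ d\<close>, which is not 1.\<close>

lemma sum_powers_roots_of_minus_1:
  assumes "N > 0"
  shows "(\<Sum>\<omega> | \<omega> ^ N = (- 1 :: complex). \<omega> ^ d) =
    of_nat N * (of_bool ([d = 0] (mod (2 * N))) - of_bool ([d = N] (mod (2 * N))))"
proof (cases "N dvd d")
  case True
  then obtain m where m: "d = N * m" by auto
  have c: "[d = 0] (mod (2 * N)) \<longleftrightarrow> even m" "[d = N] (mod (2 * N)) \<longleftrightarrow> odd m"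
  proof -
    have mod: "d mod (2 * N) = N * (m mod 2)"
      unfolding m mult.commute[of 2 N] by (rule mult_mod_right[symmetric])
    show "[d = 0] (mod (2 * N)) \<longleftrightarrow> even m" "[d = N] (mod (2 * N)) \<longleftrightarrow> odd m"
      using assms unfolding cong_def mod by (cases "even m"; simp add: odd_iff_mod_2_eq_one)+
  qed
  have "(\<Sum>\<omega> | \<omega> ^ N = (- 1 :: complex). \<omega> ^ d) = (\<Sum>\<omega> | \<omega> ^ N = (- 1 :: complex). (- 1) ^ m)"
    by (rule sum.cong) (auto simp: m power_mult)
  also have "\<dots> = of_nat N * (- 1) ^ m" using card_nth_roots[of "- 1" N] assms by simp
  finally show ?thesis using c by auto
next
  case False
  define \<zeta> where "\<zeta> = cis (2 * pi / real N)"
  have "\<zeta> ^ N = cis (real N * (2 * pi / real N))" unfolding \<zeta>_def by (rule Complex.DeMoivre)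
  moreover have "real N * (2 * pi / real N) = 2 * pi" using assms by simp
  ultimately have \<zeta>: "\<zeta> ^ N = 1" by (simp only: cis_2pi)
  then have \<zeta>0: "\<zeta> \<noteq> 0" using assms by (metis power_0_left less_numeral_extra(3) zero_neq_one)
  have \<zeta>d: "\<zeta> ^ d \<noteq> 1"
  proof
    assume "\<zeta> ^ d = 1"
    then have "cis (real d * (2 * pi / real N)) = 1" by (simp add: \<zeta>_def Complex.DeMoivre)
    then have "cos (real d * (2 * pi / real N)) = 1" by (simp add: complex_eq_iff)
    then obtain k :: int where "real d * (2 * pi / real N) = of_int k * (2 * pi)"
      unfolding cos_one_2pi_int by (auto simp: mult_ac)
    then have "real d = of_int k * real N" using assms by (simp add: field_simps)
    then have "of_int (int d) = (of_int (k * int N) :: real)" by simp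
    then have "int d = k * int N" by (simp only: of_int_eq_iff)
    then have "int N dvd int d" by simp
    with False show False by simp
  qed
  define S where "S = (\<Sum>\<omega> | \<omega> ^ N = (- 1 :: complex). \<omega> ^ d)"
  have "S = (\<Sum>\<omega> | \<omega> ^ N = (- 1 :: complex). (\<zeta> * \<omega>) ^ d)"
    unfolding S_def
    by (rule sum.reindex_bij_witness[of _ "\<lambda>\<omega>. \<zeta> * \<omega>" "\<lambda>\<omega>. \<omega> / \<zeta>"])
       (use \<zeta> \<zeta>0 in \<open>auto simp: power_mult_distrib power_divide\<close>)
  also have "\<dots> = \<zeta> ^ d * S" by (simp add: S_def power_mult_distrib sum_distrib_left)
  finally have S: "S = 0" using \<zeta>d by simp
  have "\<not> [d = N * e] (mod (2 * N))" for e
  proof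
    assume "[d = N * e] (mod (2 * N))"
    then have "[d = N * e] (mod N)" by (rule cong_dvd_modulus_nat) simp
    with False show False by (simp add: cong_def dvd_eq_mod_eq_0)
  qed
  from this[of 0] this[of 1] have "\<not> [d = 0] (mod (2 * N))" "\<not> [d = N] (mod (2 * N))"
    by simp_all
  with S show ?thesis unfolding S_def by simp
qed

context
  fixes p N g :: nat
  assumes p: "prime p" and pN: "p = 2 * N + 1" and g: "residue_primroot p g"
begin

lemma N_pos: "N > 0" using prime_gt_1_nat[OF p] pN by simp

lemma primroot_power_cong_iff: "[g ^ x = g ^ y] (mod p) \<longleftrightarrow> [x = y] (mod (2 * N))"
proof -
  have "coprime p g" "ord p g = 2 * N"
    using g pN totient_prime[OF p] by (auto simp: residue_primroot_def)
  then show ?thesis using order_divides_expdiff by metis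
qed

lemma primroot_power_cong_int_iff: "[int g ^ x = int g ^ y] (mod int p) \<longleftrightarrow> [x = y] (mod (2 * N))"
  using primroot_power_cong_iff cong_int_iff by (metis of_nat_power)

text \<open>This power is a square root of 1 modulo a prime, and it is not 1 because g has order
  2N.\<close>

lemma primroot_power_half: "[int g ^ N = - 1] (mod int p)"
proof -
  have "[int g ^ (2 * N) = int g ^ 0] (mod int p)"
    by (subst primroot_power_cong_int_iff) (simp add: cong_def)
  moreover have "int g ^ (2 * N) - int g ^ 0 = (int g ^ N - 1) * (int g ^ N + 1)"
    unfolding mult_2 power_add by (simp add: algebra_simps)
  ultimately have "int p dvd (int g ^ N - 1) * (int g ^ N + 1)"
    by (simp add: cong_iff_dvd_diff)
  then have "int p dvd int g ^ N - 1 \<or> int p dvd int g ^ N + 1"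
    using p by (simp add: prime_dvd_mult_iff)
  moreover have "\<not> [int g ^ N = int g ^ 0] (mod int p)"
    using N_pos by (subst primroot_power_cong_int_iff) (simp add: cong_def)
  ultimately show ?thesis by (simp add: cong_iff_dvd_diff)
qed

lemma ex_primroot_power:
  assumes "\<not> int p dvd a"
  obtains x where "x < 2 * N" "[a = int g ^ x] (mod int p)"
proof -
  define m where "m = nat (a mod int p)"
  have p0: "p > 0" using pN by simp
  have m: "int m = a mod int p" using p0 by (simp add: m_def)
  have "a mod int p \<noteq> 0" using assms by (simp only: dvd_eq_mod_eq_0 not_False_eq_True)
  then have "m > 0" using m by linarith
  moreover have "m < p" using m p0 by (metis of_nat_0_less_iff of_nat_less_iff pos_mod_bound)
  ultimately have "m \<in> totatives p" using p by (simp add: totatives_prime)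
  then have "m \<in> (\<lambda>i. g ^ i mod p) ` {..<totient p}"
    using residue_primroot_is_generator[of p g] g prime_gt_1_nat[OF p] by (auto simp: bij_betw_def)
  then obtain x where x: "x < 2 * N" "m = g ^ x mod p" using totient_prime[OF p] pN by auto
  then have "[a = int g ^ x] (mod int p)"
    using m by (metis cong_def mod_mod_trivial of_nat_mod of_nat_power)
  then show thesis using that x by blast
qed

lemma character_at_primroot:
  assumes "\<psi> \<in> odd_characters p"
  shows "\<psi> (int g) ^ N = - 1"
  using assms dirichlet_character_cong[OF _ primroot_power_half] dirichlet_character_power
  unfolding odd_characters_def odd_character_def by (metis (mono_tags, lifting) mem_Collect_eq)

text \<open>A character is determined by its value at the generator, and since g^N is -1, oddness
  says exactly that the Nth power of this value is -1.\<close>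

lemma bij_betw_odd_characters:
  "bij_betw (\<lambda>\<psi>. \<psi> (int g)) (odd_characters p) {\<omega>. \<omega> ^ N = - 1}"
proof (rule bij_betwI')
  fix \<psi> \<phi> assume \<psi>: "\<psi> \<in> odd_characters p" and \<phi>: "\<phi> \<in> odd_characters p"
  show "(\<psi> (int g) = \<phi> (int g)) = (\<psi> = \<phi>)"
  proof
    assume eq: "\<psi> (int g) = \<phi> (int g)"
    show "\<psi> = \<phi>"
    proof
      fix a
      show "\<psi> a = \<phi> a"
      proof (cases "int p dvd a")
        case True
        then have "\<psi> a = 0" "\<phi> a = 0" using \<psi> \<phi> prime_coprime_int_iff[OF p, of a]
          unfolding odd_characters_def dirichlet_character_def by blast+
        then show ?thesis by simp
      next
        case False
        then obtain x where "[a = int g ^ x] (mod int p)" using ex_primroot_power by blast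
        then show ?thesis using \<psi> \<phi> eq dirichlet_character_cong dirichlet_character_power
          unfolding odd_characters_def by (metis (mono_tags, lifting) mem_Collect_eq)
      qed
    qed
  qed simp
next
  show "\<psi> (int g) \<in> {\<omega>. \<omega> ^ N = - 1}" if "\<psi> \<in> odd_characters p" for \<psi>
    using character_at_primroot[OF that] by simp
next
  fix \<omega> :: complex assume "\<omega> \<in> {\<omega>. \<omega> ^ N = - 1}"
  then have \<omega>N: "\<omega> ^ N = - 1" by simp
  have \<omega>0: "\<omega> \<noteq> 0" using \<omega>N zero_power[OF N_pos] by (metis neg_equal_0_iff_equal zero_neq_one)
  have \<omega>_cong: "\<omega> ^ x = \<omega> ^ y" if "[x = y] (mod (2 * N))" for x y
  proof -
    have "\<omega> ^ z = \<omega> ^ (z mod (2 * N))" for z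
    proof -
      have "\<omega> ^ (2 * N * (z div (2 * N)) + z mod (2 * N)) = \<omega> ^ (z mod (2 * N))"
        unfolding power_add power_mult[of \<omega> "2 * N"] by (simp add: mult.commute[of 2] power_mult \<omega>N)
      then show ?thesis by simp
    qed
    then show ?thesis using that unfolding cong_def by metis
  qed
  \<comment> \<open>The exponent is a discrete logarithm, unique only modulo 2N; by
    \<open>\<omega>_cong\<close> the power does not depend on the choice.\<close>
  define \<psi> where "\<psi> a = (if int p dvd a then 0 else \<omega> ^ (SOME x. [a = int g ^ x] (mod int p)))" for a
  have ndvd: "\<not> int p dvd int g ^ x" for x
  proof -
    have "coprime p g" using g by (simp add: residue_primroot_def)
    then show ?thesis using p prime_gt_1_nat[OF p]
      by (metis coprime_power_right_iff coprime_common_divisor_nat dvd_refl int_dvd_int_iff nat_dvd_1_iff_1 of_nat_power less_irrefl)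
  qed
  have \<psi>: "\<psi> a = \<omega> ^ x" if a: "[a = int g ^ x] (mod int p)" for a x
  proof -
    have "\<not> int p dvd a" using ndvd cong_dvd_iff[OF a] by simp
    moreover have "[a = int g ^ (SOME x. [a = int g ^ x] (mod int p))] (mod int p)"
      by (rule someI[of "\<lambda>x. [a = int g ^ x] (mod int p)", OF a])
    then have "[(SOME x. [a = int g ^ x] (mod int p)) = x] (mod (2 * N))"
      using a primroot_power_cong_int_iff cong_sym cong_trans by meson
    ultimately show ?thesis unfolding \<psi>_def using \<omega>_cong by simp
  qed
  have "\<psi> \<in> odd_characters p"
    unfolding odd_characters_def dirichlet_character_def odd_character_def
  proof (intro CollectI conjI allI)
    show "p > 0" using pN by simp
    show "\<psi> 1 = 1" using \<psi>[of 1 0] by simp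
    show "\<psi> (- 1) = - 1" using \<psi>[OF cong_sym[OF primroot_power_half]] \<omega>N by simp
    show "\<psi> (a + int p) = \<psi> a" for a
      unfolding \<psi>_def by (simp add: cong_def)
    show "\<psi> a = 0 \<longleftrightarrow> \<not> coprime a (int p)" for a
      using \<omega>0 unfolding \<psi>_def by (simp add: prime_coprime_int_iff[OF p])
    show "\<psi> (a * b) = \<psi> a * \<psi> b" for a b
    proof (cases "int p dvd a \<or> int p dvd b")
      case True
      then show ?thesis unfolding \<psi>_def by auto
    next
      case False
      then obtain x y where xy: "[a = int g ^ x] (mod int p)" "[b = int g ^ y] (mod int p)"
        using ex_primroot_power by metis
      have "[a * b = int g ^ (x + y)] (mod int p)"
        unfolding power_add by (rule cong_mult[OF xy])
      from \<psi>[OF this] show ?thesis unfolding \<psi>[OF xy(1)] \<psi>[OF xy(2)] power_add .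
    qed
  qed
  moreover have "\<omega> = \<psi> (int g)" using \<psi>[of "int g" 1] by simp
  ultimately show "\<exists>\<psi>\<in>odd_characters p. \<omega> = \<psi> (int g)" by blast
qed

lemma sum_odd_characters_primroot:
  assumes i: "0 < i" "i < p"
  shows "(\<Sum>\<psi>\<in>odd_characters p. \<psi> (int n) / \<psi> (int i)) = of_nat N * residue_sign p i n"
proof (cases "p dvd n")
  case True
  then have "\<psi> (int n) = 0" if "\<psi> \<in> odd_characters p" for \<psi>
    using that prime_coprime_int_iff[OF p, of "int n"] unfolding odd_characters_def dirichlet_character_def by auto
  moreover have "residue_sign p i n = 0" using True i by (simp add: residue_sign_def)
  ultimately show ?thesis by (simp add: sum.neutral)
next
  case False
  then obtain x where x: "[int n = int g ^ x] (mod int p)" using ex_primroot_power[of "int n"] by auto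
  have "\<not> int p dvd int i" using i nat_dvd_not_less by auto
  then obtain y where y: "y < 2 * N" "[int i = int g ^ y] (mod int p)" using ex_primroot_power by blast
  \<comment> \<open>This represents x - y modulo 2N while staying in the natural numbers.\<close>
  define d where "d = x + (2 * N - y)"
  have "\<psi> (int n) / \<psi> (int i) = \<psi> (int g) ^ d" if "\<psi> \<in> odd_characters p" for \<psi>
  proof -
    have \<psi>: "dirichlet_character p \<psi>" using that by (simp add: odd_characters_def)
    have "\<psi> (int g) ^ (2 * N) = 1"
      using character_at_primroot[OF that] by (simp add: mult.commute[of 2] power_mult)
    then have "\<psi> (int g) ^ y * \<psi> (int g) ^ (2 * N - y) = 1"
      using y(1) by (simp flip: power_add)
    then show ?thesis
      unfolding d_def power_add dirichlet_character_cong[OF \<psi> x] dirichlet_character_cong[OF \<psi> y(2)]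
        dirichlet_character_power[OF \<psi>] by (metis divide_inverse inverse_unique)
  qed
  then have "(\<Sum>\<psi>\<in>odd_characters p. \<psi> (int n) / \<psi> (int i)) = (\<Sum>\<psi>\<in>odd_characters p. \<psi> (int g) ^ d)"
    by simp
  also have "\<dots> = (\<Sum>\<omega> | \<omega> ^ N = (- 1 :: complex). \<omega> ^ d)"
    by (rule sum.reindex_bij_betw[OF bij_betw_odd_characters])
  also have "\<dots> = of_nat N * (of_bool ([d = 0] (mod (2 * N))) - of_bool ([d = N] (mod (2 * N))))"
    by (rule sum_powers_roots_of_minus_1[OF N_pos])
  also have "[d = 0] (mod (2 * N)) \<longleftrightarrow> n mod p = i"
  proof -
    have "n mod p = i \<longleftrightarrow> [int n = int i] (mod int p)" using i unfolding cong_int_iff unfolding cong_def by simp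
    also have "\<dots> \<longleftrightarrow> [int g ^ x = int g ^ y] (mod int p)" using x y(2) by (meson cong_sym cong_trans)
    also have "\<dots> \<longleftrightarrow> [x = y] (mod (2 * N))" by (rule primroot_power_cong_int_iff)
    also have "\<dots> \<longleftrightarrow> [x + (2 * N - y) = y + (2 * N - y)] (mod (2 * N))" by (rule cong_add_rcancel_nat[symmetric])
    also have "\<dots> \<longleftrightarrow> [d = 0] (mod (2 * N))" using y(1) by (simp add: d_def cong_def)
    finally show ?thesis by simp
  qed
  also have "[d = N] (mod (2 * N)) \<longleftrightarrow> n mod p = p - i"
  proof -
    have "n mod p = p - i \<longleftrightarrow> [int n = int (p - i)] (mod int p)" using i by (simp only: cong_int_iff) (simp add: cong_def)
    also have "[int (p - i) = - int i] (mod int p)" using i by (simp add: of_nat_diff cong_iff_dvd_diff)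
    then have "[int n = int (p - i)] (mod int p) \<longleftrightarrow> [int n = - int i] (mod int p)"
      by (meson cong_sym cong_trans)
    also have "[- int i = int g ^ (y + N)] (mod int p)"
      using cong_mult[OF y(2) cong_sym[OF primroot_power_half]] by (simp add: power_add)
    then have "[int n = - int i] (mod int p) \<longleftrightarrow> [int g ^ x = int g ^ (y + N)] (mod int p)"
      using x by (meson cong_sym cong_trans)
    also have "\<dots> \<longleftrightarrow> [x = y + N] (mod (2 * N))" by (rule primroot_power_cong_int_iff)
    also have "\<dots> \<longleftrightarrow> [x + (2 * N - y) = y + N + (2 * N - y)] (mod (2 * N))" by (rule cong_add_rcancel_nat[symmetric])
    also have "y + N + (2 * N - y) = N + 2 * N" using y(1) by simp
    also have "[x + (2 * N - y) = N + 2 * N] (mod (2 * N)) \<longleftrightarrow> [d = N] (mod (2 * N))" by (simp add: d_def cong_def)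
    finally show ?thesis by simp
  qed
  finally show ?thesis by (simp add: residue_sign_def)
qed

end

lemma odd_characters_orthogonal:
  assumes "prime p" "p > 2" "0 < i" "i < p"
  shows "(\<Sum>\<psi>\<in>odd_characters p. \<psi> (int n) / \<psi> (int i)) = (of_nat p - 1) / 2 * residue_sign p i n"
    and "finite (odd_characters p)" and "of_nat (card (odd_characters p)) = (of_nat p - 1) / (2 :: complex)"
proof -
  obtain N where N: "p = 2 * N + 1" using prime_odd_nat[OF assms(1,2)] by (rule oddE)
  obtain g where g: "residue_primroot p g" using prime_primitive_root_exists[OF prime_gt_1_nat assms(1)] assms(1) by blast
  note bij = bij_betw_odd_characters[OF assms(1) N g]
  have "N > 0" using assms(2) N by simp
  then show "finite (odd_characters p)" "of_nat (card (odd_characters p)) = (of_nat p - 1) / (2 :: complex)"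
    using bij_betw_finite[OF bij] bij_betw_same_card[OF bij] card_nth_roots[of "- 1" N] N by auto
  show "(\<Sum>\<psi>\<in>odd_characters p. \<psi> (int n) / \<psi> (int i)) = (of_nat p - 1) / 2 * residue_sign p i n"
    using sum_odd_characters_primroot[OF assms(1) N g assms(3,4)] N by simp
qed

text \<open>The only proper divisor of a prime is 1, and a character modulo 1 takes equal values at
  1 and -1. Oddness therefore already forces primitivity.\<close>

lemma primitive_odd_characters:
  assumes p: "prime p"
  shows "{\<psi>. primitive_character p \<psi> \<and> odd_character \<psi>} = odd_characters p"
proof -
  have "primitive_character p \<psi>" if \<psi>: "dirichlet_character p \<psi>" "odd_character \<psi>" for \<psi>
    unfolding primitive_character_def
  proof (intro conjI \<psi>(1) notI)
    assume "\<exists>d \<phi>. d dvd p \<and> d < p \<and> dirichlet_character d \<phi> \<and> (\<forall>a. coprime a (int p) \<longrightarrow> \<psi> a = \<phi> a)"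
    then obtain d \<phi> where d: "d dvd p" "d < p" "dirichlet_character d \<phi>" "\<And>a. coprime a (int p) \<Longrightarrow> \<psi> a = \<phi> a"
      by blast
    have "d = 1" using d p by (metis less_irrefl prime_nat_iff)
    then have "\<phi> (- 1) = \<phi> 1" using dirichlet_character_cong[OF d(3)] by simp
    then have "\<psi> (- 1) = \<psi> 1" using d(4) by simp
    then show False using \<psi> by (simp add: odd_character_def dirichlet_character_def)
  qed
  then show ?thesis by (auto simp: odd_characters_def primitive_character_def)
qed

section \<open>The mean of the Eisenstein series\<close>

text \<open>Group the factors by j = m*k + r along the partial products of length n*k. For p = 5
  this recovers the full product (q;q) from the residue classes.\<close>

lemma qpoch_dissect:
  assumes q: "norm q < 1" and k: "k > 0"
  shows "qpoch a q = (\<Prod>r<k. qpoch (a * q ^ r) (q ^ k))"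
proof -
  have qk: "norm (q ^ k) < 1" using q k by (simp add: norm_power power_less_one_iff)
  have "strict_mono (\<lambda>n. n * k)" using k by (intro strict_monoI) simp
  then have "((\<lambda>n. \<Prod>j<n. 1 - a * q ^ j) \<circ> (\<lambda>n. n * k)) \<longlonglongrightarrow> qpoch a q"
    by (rule LIMSEQ_subseq_LIMSEQ[OF qpoch_LIMSEQ[OF q]])
  moreover have "(\<Prod>j<n * k. 1 - a * q ^ j) = (\<Prod>r<k. \<Prod>m<n. 1 - (a * q ^ r) * (q ^ k) ^ m)" for n
  proof -
    have "(\<Prod>j<n * k. 1 - a * q ^ j) = (\<Prod>m<n. \<Prod>j\<in>{m * k..<m * k + k}. 1 - a * q ^ j)"
      by (rule prod.nat_group[symmetric])
    also have "\<dots> = (\<Prod>m<n. \<Prod>r<k. 1 - (a * q ^ r) * (q ^ k) ^ m)"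
    proof (rule prod.cong[OF refl])
      fix m
      have "a * q ^ r * (q ^ k) ^ m = a * q ^ (m * k + r)" for r
        by (simp add: power_add mult_ac flip: power_mult)
      note * = this
      show "(\<Prod>j\<in>{m * k..<m * k + k}. 1 - a * q ^ j) = (\<Prod>r<k. 1 - (a * q ^ r) * (q ^ k) ^ m)"
        by (rule prod.reindex_bij_witness[of _ "\<lambda>r. m * k + r" "\<lambda>j. j - m * k"]) (auto simp: *)
    qed
    also have "\<dots> = (\<Prod>r<k. \<Prod>m<n. 1 - (a * q ^ r) * (q ^ k) ^ m)" by (rule prod.swap)
    finally show ?thesis .
  qed
  moreover have "(\<lambda>n. \<Prod>r<k. \<Prod>m<n. 1 - (a * q ^ r) * (q ^ k) ^ m) \<longlonglongrightarrow> (\<Prod>r<k. qpoch (a * q ^ r) (q ^ k))"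
    by (intro tendsto_prod qpoch_LIMSEQ qk)
  ultimately show ?thesis by (auto simp: o_def intro: LIMSEQ_unique)
qed

lemma theta_product_reflect: "i \<le> p \<Longrightarrow> theta_product p (p - i) q = theta_product p i q"
  by (simp add: theta_product_def mult.commute)

text \<open>The denominators have norm at least 1 - |q|, so a geometric series dominates. The
  convergence is needed to exchange the sum over characters with the series over n.\<close>

lemma summable_bounded_lambert:
  fixes f :: "nat \<Rightarrow> complex"
  assumes q: "norm q < 1" and f: "\<And>n. norm (f n) \<le> B"
  shows "summable (\<lambda>n. f n * (q ^ Suc n / (1 - q ^ Suc n)))"
proof (rule summable_comparison_test'[where N = 0])
  show "summable (\<lambda>n. B / (1 - norm q) * norm q ^ Suc n)"
    using q by (intro summable_mult) (simp add: summable_mult)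
  fix n
  have "norm (q ^ Suc n) \<le> norm q"
    using q power_decreasing[of 1 "Suc n" "norm q"] by (simp add: norm_power del: power_Suc)
  then have "1 - norm q \<le> norm (1 - q ^ Suc n)"
    using norm_triangle_ineq2[of 1 "q ^ Suc n"] by (simp del: power_Suc)
  then have "norm (q ^ Suc n) / norm (1 - q ^ Suc n) \<le> norm q ^ Suc n / (1 - norm q)"
    using q by (simp add: norm_power frac_le del: power_Suc)
  then have "norm (f n) * (norm (q ^ Suc n) / norm (1 - q ^ Suc n)) \<le> B * (norm q ^ Suc n / (1 - norm q))"
    using order.trans[OF norm_ge_zero f] by (intro mult_mono f) auto
  then show "norm (f n * (q ^ Suc n / (1 - q ^ Suc n))) \<le> B / (1 - norm q) * norm q ^ Suc n"
    by (simp add: norm_mult norm_divide del: power_Suc)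
qed

theorem eisenstein_mean_eq_theta_quotient:
  assumes \<tau>: "Im \<tau> > 0" and q: "q = nome \<tau>" and p: "prime p"
    and ijk: "0 < i" "0 < j" "0 < k" "i + j + k < p"
    and bal: "\<And>m. m \<in> {1..<p} \<Longrightarrow> i * m mod p + j * m mod p + k * m mod p =
      (i + j + k) * m mod p + (if m = 1 then 0 else if m = p - 1 then 2 * p else p)"
  shows "eisenstein_mean p \<tau> =
    qpoch (q ^ p) (q ^ p) ^ 2 * theta_product p (i + j) q * theta_product p (i + k) q * theta_product p (j + k) q
      / (theta_product p i q * theta_product p j q * theta_product p k q * theta_product p (i + j + k) q)"
proof -
  define g where "g n = q ^ n / (1 - q ^ n)" for n
  define C where "C \<psi> = 2 / dirichlet_L \<psi> 0" for \<psi>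
  define R where "R n = residue_sign p i n + residue_sign p j n + residue_sign p k n - residue_sign p (i + j + k) n" for n
  define Q where "Q = qpoch (q ^ p) (q ^ p) ^ 2 * theta_product p (i + j) q * theta_product p (i + k) q * theta_product p (j + k) q
      / (theta_product p i q * theta_product p j q * theta_product p k q * theta_product p (i + j + k) q)"
  have p2: "p > 2" using ijk by simp
  have p1: "(of_nat p - 1 :: complex) \<noteq> 0" using p2 by (metis One_nat_def eq_iff_diff_eq_0 nat_neq_iff numeral_2_eq_2 of_nat_1 of_nat_eq_iff not_less_eq lessI less_trans)
  have nq: "norm q < 1" using \<tau> by (simp add: q nome_def)
  have C: "C \<psi> = 1 / \<psi> (int i) + 1 / \<psi> (int j) + 1 / \<psi> (int k) - 1 / \<psi> (int (i + j + k))"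
    if "\<psi> \<in> odd_characters p" for \<psi>
    unfolding C_def using that by (intro dirichlet_L_odd_0_inverse[OF p p2] ijk bal) (auto simp: odd_characters_def)
  have sm: "summable (\<lambda>n. \<psi> (int (Suc n)) * g (Suc n))" if "\<psi> \<in> odd_characters p" for \<psi>
  proof -
    have "mean_free_periodic p (\<lambda>m. \<psi> (int (Suc m)))"
      using that p2 by (intro mean_free_periodic_odd_character) (auto simp: odd_characters_def)
    then obtain B where "\<And>n. norm (\<psi> (int (Suc n))) \<le> B"
      using mean_free_periodic_bounded by blast
    then show ?thesis unfolding g_def by (rule summable_bounded_lambert[OF nq])
  qed
  have orth: "(\<Sum>\<psi>\<in>odd_characters p. C \<psi> * \<psi> (int n)) = (of_nat p - 1) / 2 * R n" for n
  proof -
    have "(\<Sum>\<psi>\<in>odd_characters p. C \<psi> * \<psi> (int n)) = (\<Sum>\<psi>\<in>odd_characters p.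
        \<psi> (int n) / \<psi> (int i) + \<psi> (int n) / \<psi> (int j) + \<psi> (int n) / \<psi> (int k) - \<psi> (int n) / \<psi> (int (i + j + k)))"
      by (rule sum.cong) (simp_all add: C algebra_simps)
    also have "\<dots> = (of_nat p - 1) / 2 * residue_sign p i n + (of_nat p - 1) / 2 * residue_sign p j n
        + (of_nat p - 1) / 2 * residue_sign p k n - (of_nat p - 1) / 2 * residue_sign p (i + j + k) n"
      unfolding sum.distrib sum_subtractf
      using ijk by (subst (1 2 3 4) odd_characters_orthogonal(1)[OF p p2]) auto
    finally show ?thesis by (simp only: R_def ring_distribs)
  qed
  have lam: "(\<lambda>n. R (Suc n) * g (Suc n)) sums (Q - 1)"
    unfolding R_def g_def Q_def using lambert_theta_quotient[OF \<tau> q _ ijk] p2 by simp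
  have "(\<Sum>\<psi>\<in>odd_characters p. eisenstein1 \<psi> \<tau>)
      = (\<Sum>\<psi>\<in>odd_characters p. 1 + (\<Sum>n. C \<psi> * \<psi> (int (Suc n)) * g (Suc n)))"
  proof (rule sum.cong[OF refl])
    fix \<psi> assume \<psi>: "\<psi> \<in> odd_characters p"
    have "(\<Sum>n. C \<psi> * (\<psi> (int (Suc n)) * g (Suc n))) = C \<psi> * (\<Sum>n. \<psi> (int (Suc n)) * g (Suc n))"
      by (rule suminf_mult[OF sm[OF \<psi>]])
    then show "eisenstein1 \<psi> \<tau> = 1 + (\<Sum>n. C \<psi> * \<psi> (int (Suc n)) * g (Suc n))"
      unfolding eisenstein1_def g_def C_def q by (simp only: mult.assoc)
  qed
  also have "\<dots> = of_nat (card (odd_characters p)) + (\<Sum>\<psi>\<in>odd_characters p. \<Sum>n. C \<psi> * \<psi> (int (Suc n)) * g (Suc n))"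
    by (simp add: sum.distrib)
  also have "(\<Sum>\<psi>\<in>odd_characters p. \<Sum>n. C \<psi> * \<psi> (int (Suc n)) * g (Suc n))
      = (\<Sum>n. \<Sum>\<psi>\<in>odd_characters p. C \<psi> * \<psi> (int (Suc n)) * g (Suc n))"
    using summable_mult[OF sm] by (intro suminf_sum[symmetric]) (simp add: mult.assoc)
  also have "\<dots> = (\<Sum>n. (of_nat p - 1) / 2 * (R (Suc n) * g (Suc n)))"
    unfolding sum_distrib_right[symmetric] orth by (simp only: mult.assoc)
  also have "\<dots> = (of_nat p - 1) / 2 * (Q - 1)"
    using sums_mult[OF lam] sums_unique by metis
  \<comment> \<open>The constant terms of the Eisenstein series contribute (p-1)/2 in total, which
    absorbs the -1 in Q - 1.\<close>
  also have "of_nat (card (odd_characters p)) = (of_nat p - 1) / (2 :: complex)"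
    using odd_characters_orthogonal(3)[OF p p2, of i] ijk by simp
  finally have sum: "(\<Sum>\<psi>\<in>odd_characters p. eisenstein1 \<psi> \<tau>) = (of_nat p - 1) / 2 * Q"
    by (simp add: right_diff_distrib)
  show ?thesis
    unfolding eisenstein_mean_def primitive_odd_characters[OF p] Q_def[symmetric] sum using p1 by simp
qed

theorem theorem3p1:
  fixes \<tau> q :: complex
  assumes "Im \<tau> > 0"
    and "q = nome \<tau>"
  shows "eisenstein_mean 5 \<tau> = qpoch q q ^ 2 / qpochs [q, q^4] (q^5) ^ 5
    \<and> eisenstein_mean 7 \<tau> = qpochs [q^3, q^4, q^7, q^7] (q^7) / qpochs [q, q^6] (q^7) ^ 2
    \<and> eisenstein_mean 11 \<tau> =
        qpochs [q^4, q^7, q^11, q^11] (q^11) / qpochs [q, q^10, q^2, q^9] (q^11)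
    \<and> eisenstein_mean 13 \<tau> =
        qpochs [q^6, q^7, q^13, q^13] (q^13) / qpochs [q, q^12, q^3, q^10] (q^13)
    \<and> eisenstein_mean 17 \<tau> =
        qpochs [q^8, q^9, q^17, q^17] (q^17) / qpochs [q^2, q^15, q^3, q^14] (q^17)
    \<and> eisenstein_mean 19 \<tau> =
        qpochs [q^8, q^11, q^9, q^10, q^19, q^19] (q^19)
          / qpochs [q^3, q^16, q^4, q^15, q^5, q^14] (q^19)"
proof -
  note main = eisenstein_mean_eq_theta_quotient[OF assms]
  note nonzero = theta_product_nonzero[OF assms]
  have q: "norm q < 1" using norm_nome_less_1[OF assms, of 1] by simp
  let ?\<theta> = "\<lambda>p i. theta_product p i q" and ?J = "\<lambda>p. qpoch (q ^ p) (q ^ p)"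
  have "eisenstein_mean 5 \<tau> = qpoch q q ^ 2 / qpochs [q, q^4] (q^5) ^ 5"
  proof -
    have "eisenstein_mean 5 \<tau> = ?J 5 ^ 2 * ?\<theta> 5 (1 + 1) * ?\<theta> 5 (1 + 1) * ?\<theta> 5 (1 + 1)
        / (?\<theta> 5 1 * ?\<theta> 5 1 * ?\<theta> 5 1 * ?\<theta> 5 (1 + 1 + 1))"
      \<comment> \<open>The last premise, \<open>bal\<close>, is verified by running through all m
        below p.\<close>
      by (rule main) (simp, simp, simp, simp, simp, simp add: upt_conv_Cons atLeastLessThan_upt, fastforce)
    also have "\<dots> = ?J 5 ^ 2 * ?\<theta> 5 2 * ?\<theta> 5 2 * ?\<theta> 5 2 / (?\<theta> 5 1 * ?\<theta> 5 1 * ?\<theta> 5 1 * ?\<theta> 5 2)"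
      using theta_product_reflect[of 2 5 q] by (simp add: eval_nat_numeral)
    \<comment> \<open>Extending the fraction by the square of \<open>?\<theta> 5 1\<close> completes
      the numerator to the square of the product over all residue classes modulo 5.\<close>
    also have "\<dots> = (?J 5 * ?\<theta> 5 1 * ?\<theta> 5 2) ^ 2 / ?\<theta> 5 1 ^ 5"
      using nonzero[of 5 1] nonzero[of 5 2] by (simp add: field_simps eval_nat_numeral)
    also have "?J 5 * ?\<theta> 5 1 * ?\<theta> 5 2 = qpoch q q"
      using qpoch_dissect[OF q, of 5 q] by (simp add: theta_product_def eval_nat_numeral lessThan_Suc)
    finally show ?thesis by (simp add: qpochs_def theta_product_def)
  qed
  moreover have "eisenstein_mean 7 \<tau> = qpochs [q^3, q^4, q^7, q^7] (q^7) / qpochs [q, q^6] (q^7) ^ 2"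
  proof -
    have "eisenstein_mean 7 \<tau> = ?J 7 ^ 2 * ?\<theta> 7 (1 + 1) * ?\<theta> 7 (1 + 2) * ?\<theta> 7 (1 + 2)
        / (?\<theta> 7 1 * ?\<theta> 7 1 * ?\<theta> 7 2 * ?\<theta> 7 (1 + 1 + 2))"
      by (rule main) (simp, simp, simp, simp, simp, simp add: upt_conv_Cons atLeastLessThan_upt, fastforce)
    \<comment> \<open>Indices above p/2 are folded back by i -> p - i. The folded theta factor of i
      + j + k then cancels against one in the numerator; the same happens for the later
      primes.\<close>
    also have "\<dots> = ?J 7 ^ 2 * ?\<theta> 7 2 * ?\<theta> 7 3 * ?\<theta> 7 3 / (?\<theta> 7 1 * ?\<theta> 7 1 * ?\<theta> 7 2 * ?\<theta> 7 3)"
      using theta_product_reflect[of 3 7 q] by (simp del: One_nat_def)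
    also have "\<dots> = ?J 7 ^ 2 * ?\<theta> 7 3 / ?\<theta> 7 1 ^ 2"
      using nonzero[of 7 2] nonzero[of 7 3] by (simp add: power2_eq_square)
    finally show ?thesis by (simp add: qpochs_def theta_product_def power2_eq_square mult_ac)
  qed
  moreover have "eisenstein_mean 11 \<tau> =
        qpochs [q^4, q^7, q^11, q^11] (q^11) / qpochs [q, q^10, q^2, q^9] (q^11)"
  proof -
    have "eisenstein_mean 11 \<tau> = ?J 11 ^ 2 * ?\<theta> 11 (1 + 2) * ?\<theta> 11 (1 + 3) * ?\<theta> 11 (2 + 3)
        / (?\<theta> 11 1 * ?\<theta> 11 2 * ?\<theta> 11 3 * ?\<theta> 11 (1 + 2 + 3))"
      by (rule main) (simp, simp, simp, simp, simp, simp add: upt_conv_Cons atLeastLessThan_upt, fastforce)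
    also have "\<dots> = ?J 11 ^ 2 * ?\<theta> 11 3 * ?\<theta> 11 4 * ?\<theta> 11 5 / (?\<theta> 11 1 * ?\<theta> 11 2 * ?\<theta> 11 3 * ?\<theta> 11 5)"
      using theta_product_reflect[of 5 11 q] by (simp del: One_nat_def)
    also have "\<dots> = ?J 11 ^ 2 * ?\<theta> 11 4 / (?\<theta> 11 1 * ?\<theta> 11 2)"
      using nonzero[of 11 3] nonzero[of 11 5] by simp
    finally show ?thesis by (simp add: qpochs_def theta_product_def power2_eq_square mult_ac)
  qed
  moreover have "eisenstein_mean 13 \<tau> =
        qpochs [q^6, q^7, q^13, q^13] (q^13) / qpochs [q, q^12, q^3, q^10] (q^13)"
  proof -
    have "eisenstein_mean 13 \<tau> = ?J 13 ^ 2 * ?\<theta> 13 (1 + 3) * ?\<theta> 13 (1 + 4) * ?\<theta> 13 (3 + 4)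
        / (?\<theta> 13 1 * ?\<theta> 13 3 * ?\<theta> 13 4 * ?\<theta> 13 (1 + 3 + 4))"
      by (rule main) (simp, simp, simp, simp, simp, simp add: upt_conv_Cons atLeastLessThan_upt, fastforce)
    also have "\<dots> = ?J 13 ^ 2 * ?\<theta> 13 4 * ?\<theta> 13 5 * ?\<theta> 13 6 / (?\<theta> 13 1 * ?\<theta> 13 3 * ?\<theta> 13 4 * ?\<theta> 13 5)"
      using theta_product_reflect[of 6 13 q] theta_product_reflect[of 5 13 q] by (simp del: One_nat_def)
    also have "\<dots> = ?J 13 ^ 2 * ?\<theta> 13 6 / (?\<theta> 13 1 * ?\<theta> 13 3)"
      using nonzero[of 13 4] nonzero[of 13 5] by simp
    finally show ?thesis by (simp add: qpochs_def theta_product_def power2_eq_square mult_ac)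
  qed
  moreover have "eisenstein_mean 17 \<tau> =
        qpochs [q^8, q^9, q^17, q^17] (q^17) / qpochs [q^2, q^15, q^3, q^14] (q^17)"
  proof -
    have "eisenstein_mean 17 \<tau> = ?J 17 ^ 2 * ?\<theta> 17 (2 + 3) * ?\<theta> 17 (2 + 5) * ?\<theta> 17 (3 + 5)
        / (?\<theta> 17 2 * ?\<theta> 17 3 * ?\<theta> 17 5 * ?\<theta> 17 (2 + 3 + 5))"
      by (rule main) (simp, simp, simp, simp, simp, simp add: upt_conv_Cons atLeastLessThan_upt, fastforce)
    also have "\<dots> = ?J 17 ^ 2 * ?\<theta> 17 5 * ?\<theta> 17 7 * ?\<theta> 17 8 / (?\<theta> 17 2 * ?\<theta> 17 3 * ?\<theta> 17 5 * ?\<theta> 17 7)"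
      using theta_product_reflect[of 7 17 q] by (simp del: One_nat_def)
    also have "\<dots> = ?J 17 ^ 2 * ?\<theta> 17 8 / (?\<theta> 17 2 * ?\<theta> 17 3)"
      using nonzero[of 17 5] nonzero[of 17 7] by simp
    finally show ?thesis by (simp add: qpochs_def theta_product_def power2_eq_square mult_ac)
  qed
  moreover have "eisenstein_mean 19 \<tau> =
        qpochs [q^8, q^11, q^9, q^10, q^19, q^19] (q^19)
          / qpochs [q^3, q^16, q^4, q^15, q^5, q^14] (q^19)"
  proof -
    have "eisenstein_mean 19 \<tau> = ?J 19 ^ 2 * ?\<theta> 19 (3 + 4) * ?\<theta> 19 (3 + 5) * ?\<theta> 19 (4 + 5)
        / (?\<theta> 19 3 * ?\<theta> 19 4 * ?\<theta> 19 5 * ?\<theta> 19 (3 + 4 + 5))"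
      by (rule main) (simp, simp, simp, simp, simp, simp add: upt_conv_Cons atLeastLessThan_upt, fastforce)
    also have "\<dots> = ?J 19 ^ 2 * ?\<theta> 19 7 * ?\<theta> 19 8 * ?\<theta> 19 9 / (?\<theta> 19 3 * ?\<theta> 19 4 * ?\<theta> 19 5 * ?\<theta> 19 7)"
      using theta_product_reflect[of 7 19 q] by (simp del: One_nat_def)
    also have "\<dots> = ?J 19 ^ 2 * ?\<theta> 19 8 * ?\<theta> 19 9 / (?\<theta> 19 3 * ?\<theta> 19 4 * ?\<theta> 19 5)"
      using nonzero[of 19 7] by (simp add: mult.assoc)
    finally show ?thesis by (simp add: qpochs_def theta_product_def power2_eq_square mult_ac)
  qed
  ultimately show ?thesis by blast
qed

end
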